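(* Let $(X,d,\mu)$ be a metric measure space. Let $p,s\in\mathcal{P}_b(X)$ and $q\in\mathcal{P}(X)$. Then the following statements are equivalent. (i) We have the compact embedding $$N^{s(\cdot)}_{p(\cdot),q(\cdot)}(X,d,\mu)\hookrightarrow\hookrightarrow L^{p(\cdot)}(X,\mu).$$ (ii) For every $r\in\mathcal{P}(X)$ and $t\in\mathcal{P}_b(X)$ such that $t\ll s$ we have the compact embeddings $$N^{s(\cdot)}_{p(\cdot),q(\cdot)}(X,d,\mu)\hookrightarrow\hookrightarrow M^{t(\cdot)}_{p(\cdot),r(\cdot)}(X,d,\mu),\qquad N^{s(\cdot)}_{p(\cdot),q(\cdot)}(X,d,\mu)\hookrightarrow\hookrightarrow N^{t(\cdot)}_{p(\cdot),r(\cdot)}(X,d,\mu).$$ (iii) There exist $r\in\mathcal{P}(X)$ and $t\in\mathcal{P}_b(X)$ such that $t\ll s$ and we have at least one of the following compact embeddings: $$N^{s(\cdot)}_{p(\cdot),q(\cdot)}(X,d,\mu)\hookrightarrow\hookrightarrow M^{t(\cdot)}_{p(\cdot),r(\cdot)}(X,d,\mu),\qquad N^{s(\cdot)}_{p(\cdot),q(\cdot)}(X,d,\mu)\hookrightarrow\hookrightarrow N^{t(\cdot)}_{p(\cdot),r(\cdot)}(X,d,\mu).$$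
   Context: A metric measure space $(X,d,\mu)$ is a metric space $(X,d)$ with a Borel measure $\mu$ such that $0<\mu(B(x,r))<\infty$ for every open ball $B(x,r)$, $x\in X$, $r\in(0,\infty)$ (in particular $X$ is separable). Exponents: for measurable $p$ on $X$, $p^+=\operatorname{ess\,sup}_X p$, $p^-=\operatorname{ess\,inf}_X p$. $\mathcal{P}(X)$ is the set of measurable $p:X\to(0,\infty]$ with $p^->0$; $\mathcal{P}_b(X)=\mathcal{P}(X)\cap L^\infty(X,\mu)$. $p_1\ll p_2$ means $(p_2-p_1)^->0$. Lebesgue spaces: for $p\in\mathcal{P}_b(X)$ let $\rho_{p(\cdot)}(u)=\int_X|u(x)|^{p(x)}\,d\mu(x)$. $L^{p(\cdot)}(X,\mu)$ is the space of measurable $u$ with $\rho_{p(\cdot)}(\lambda u)<\infty$ for some $\lambda>0$, with quasi-norm $\|u\|_{L^{p(\cdot)}}=\inf\{\lambda>0:\rho_{p(\cdot)}(u/\lambda)\le1\}$. Mixed spaces ($p\in\mathcal{P}_b(X)$, $q\in\mathcal{P}(X)$): for sequences $\{u_k\}_{k\in\mathbb{Z}}$ of measurable functions, $\|\{u_k\}\|_{L^{p(\cdot)}(\ell^{q(\cdot)})}=\big\|\,\|\{u_k(\cdot)\}_k\|_{\ell^{q(\cdot)}}\big\|_{L^{p(\cdot)}}$ (pointwise $\ell^{q(x)}(\mathbb{Z})$ quasi-norm, supremum if $q(x)=\infty$). Let $\rho_{\ell^{q(\cdot)}(L^{p(\cdot)})}(\{u_k\})=\sum_{k\in\mathbb{Z}}\inf\{\lambda_k>0:\rho_{p(\cdot)}(u_k/\lambda_k^{1/q(\cdot)})\le1\}$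 (with $\lambda^{1/\infty}=1$) and $\|\{u_k\}\|_{\ell^{q(\cdot)}(L^{p(\cdot)})}=\inf\{m>0:\rho_{\ell^{q(\cdot)}(L^{p(\cdot)})}(\{u_k\}/m)\le1\}$. Gradients: let $s\in\mathcal{P}_b(X)$ and $u:X\to\overline{\mathbb{R}}$ be measurable and finite a.e. A sequence $\{g_k\}_{k\in\mathbb{Z}}$ of non-negative measurable functions is a vector $s(\cdot)$-gradient of $u$ (written $\{g_k\}\in\mathbb{D}^{s(\cdot)}(u)$) if there is a $\mu$-null set $N_u$ such that $|u(x)-u(y)|\le d(x,y)^{s(x)}g_k(x)+d(x,y)^{s(y)}g_k(y)$ for all $k\in\mathbb{Z}$ and all $x,y\in X\setminus N_u$ with $2^{-k-1}\le d(x,y)<2^{-k}$. Function spaces: $\|u\|_{\dot M^{s(\cdot)}_{p(\cdot),q(\cdot)}}=\inf_{g\in\mathbb{D}^{s(\cdot)}(u)}\|g\|_{L^{p(\cdot)}(\ell^{q(\cdot)})}$ and $\|u\|_{\dot N^{s(\cdot)}_{p(\cdot),q(\cdot)}}=\inf_{g\in\mathbb{D}^{s(\cdot)}(u)}\|g\|_{\ell^{q(\cdot)}(L^{p(\cdot)})}$. For $A\in\{M,N\}$, $A^{s(\cdot)}_{p(\cdot),q(\cdot)}(X,d,\mu)$ is the space of $u\in L^{p(\cdot)}(X,\mu)$ with $\|u\|_{\dot A^{s(\cdot)}_{p(\cdot),q(\cdot)}}<\infty$, with quasi-norm $\|u\|_{L^{p(\cdot)}}+\|u\|_{\dot A^{s(\cdot)}_{p(\cdot),q(\cdot)}}$.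 $Y\hookrightarrow\hookrightarrow Z$ (compact embedding) means $Y\subseteq Z$ with continuous inclusion mapping bounded subsets of $Y$ to totally bounded subsets of $Z$. *)

theory Defs
  imports "HOL-Analysis.Analysis" "HOL-Probability.Essential_Supremum"
begin

text \<open>The metric space \<open>X\<close> is a type of class \<open>metric_space\<close>; separability follows from
  the condition on balls.\<close>

definition metric_measure_space :: "'a::metric_space measure \<Rightarrow> bool" where
  "metric_measure_space M \<longleftrightarrow>
     sets M = sets borel \<and>
     (\<forall>x. \<forall>r>0. 0 < emeasure M (ball x r) \<and> emeasure M (ball x r) < \<infinity>)"

definition essinf :: "'a measure \<Rightarrow> ('a \<Rightarrow> ereal) \<Rightarrow> ereal" where
  "essinf M f = - esssup M (\<lambda>x. - f x)"

definition exponents :: "'a measure \<Rightarrow> ('a \<Rightarrow> ereal) set" where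
  "exponents M = {p \<in> borel_measurable M. (\<forall>x\<in>space M. 0 < p x) \<and> 0 < essinf M p}"

definition bounded_exponents :: "'a measure \<Rightarrow> ('a \<Rightarrow> ereal) set" where
  "bounded_exponents M = {p \<in> exponents M. esssup M p < \<infinity>}"

text \<open>In the relation \<open>p1 \<lless> p2\<close>, the difference is only ever formed for bounded exponents,
  where \<open>\<infinity> - \<infinity>\<close> can occur on a null set only.\<close>

definition exponent_ll :: "'a measure \<Rightarrow> ('a \<Rightarrow> ereal) \<Rightarrow> ('a \<Rightarrow> ereal) \<Rightarrow> bool" where
  "exponent_ll M p1 p2 \<longleftrightarrow> 0 < essinf M (\<lambda>x. p2 x - p1 x)"

text \<open>The power \<open>|a|\<^sup>r\<close> for extended real \<open>a\<close> and \<open>r > 0\<close>. (A bounded exponent may take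
  the value \<open>\<infinity>\<close> on a null set, where \<open>real_of_ereal\<close> gives the junk value 0;
  this affects no integral and no gradient below.)\<close>

definition abs_powr :: "ereal \<Rightarrow> real \<Rightarrow> ennreal" where
  "abs_powr a r = (if \<bar>a\<bar> = \<infinity> then \<infinity> else ennreal (real_of_ereal \<bar>a\<bar> powr r))"

definition modular :: "'a measure \<Rightarrow> ('a \<Rightarrow> ereal) \<Rightarrow> ('a \<Rightarrow> ereal) \<Rightarrow> ennreal" where
  "modular M p u = (\<integral>\<^sup>+ x. abs_powr (u x) (real_of_ereal (p x)) \<partial>M)"

definition Lp_qnorm :: "'a measure \<Rightarrow> ('a \<Rightarrow> ereal) \<Rightarrow> ('a \<Rightarrow> ereal) \<Rightarrow> ennreal" where
  "Lp_qnorm M p u =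
     (INF l\<in>{l::real. 0 < l \<and> modular M p (\<lambda>x. u x / ereal l) \<le> 1}. ennreal l)"

definition lq_qnorm :: "ereal \<Rightarrow> (int \<Rightarrow> ereal) \<Rightarrow> ereal" where
  "lq_qnorm q a =
     (if q = \<infinity> then (SUP k. \<bar>a k\<bar>)
      else enn2ereal (abs_powr (enn2ereal (\<Sum>\<^sub>\<infinity>k\<in>UNIV. abs_powr (a k) (real_of_ereal q)))
                               (1 / real_of_ereal q)))"

definition Lp_lq_qnorm ::
  "'a measure \<Rightarrow> ('a \<Rightarrow> ereal) \<Rightarrow> ('a \<Rightarrow> ereal) \<Rightarrow> (int \<Rightarrow> 'a \<Rightarrow> ereal) \<Rightarrow> ennreal" where
  "Lp_lq_qnorm M p q u = Lp_qnorm M p (\<lambda>x. lq_qnorm (q x) (\<lambda>k. u k x))"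

text \<open>Since \<open>1 / \<infinity> = 0\<close> in \<open>ereal\<close>, the convention \<open>\<lambda>\<^bsup>1/\<infinity>\<^esup> = 1\<close> is built in.\<close>

definition lq_Lp_modular ::
  "'a measure \<Rightarrow> ('a \<Rightarrow> ereal) \<Rightarrow> ('a \<Rightarrow> ereal) \<Rightarrow> (int \<Rightarrow> 'a \<Rightarrow> ereal) \<Rightarrow> ennreal" where
  "lq_Lp_modular M p q u =
     (\<Sum>\<^sub>\<infinity>k\<in>UNIV.
        INF l\<in>{l::real. 0 < l \<and>
                 modular M p (\<lambda>x. u k x / ereal (l powr real_of_ereal (1 / q x))) \<le> 1}.
          ennreal l)"

definition lq_Lp_qnorm ::
  "'a measure \<Rightarrow> ('a \<Rightarrow> ereal) \<Rightarrow> ('a \<Rightarrow> ereal) \<Rightarrow> (int \<Rightarrow> 'a \<Rightarrow> ereal) \<Rightarrow> ennreal" where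
  "lq_Lp_qnorm M p q u =
     (INF m\<in>{m::real. 0 < m \<and> lq_Lp_modular M p q (\<lambda>k x. u k x / ereal m) \<le> 1}. ennreal m)"

text \<open>Used for \<open>u\<close> measurable and finite almost everywhere; points with \<open>u x = \<plusminus>\<infinity>\<close>
  can be put into the exceptional set \<open>N\<close>.\<close>

definition gradients ::
  "'a::metric_space measure \<Rightarrow> ('a \<Rightarrow> ereal) \<Rightarrow> ('a \<Rightarrow> ereal) \<Rightarrow> (int \<Rightarrow> 'a \<Rightarrow> ereal) set" where
  "gradients M s u =
     {g. (\<forall>k. g k \<in> borel_measurable M) \<and> (\<forall>k x. 0 \<le> g k x) \<and>
         (\<exists>N\<in>null_sets M. \<forall>k. \<forall>x\<in>- N. \<forall>y\<in>- N.
            2 powi (- k - 1) \<le> dist x y \<and> dist x y < 2 powi (- k) \<longrightarrow>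
            \<bar>u x - u y\<bar> \<le> ereal (dist x y powr real_of_ereal (s x)) * g k x
                         + ereal (dist x y powr real_of_ereal (s y)) * g k y)}"

text \<open>The infimum over the empty set is \<open>\<infinity>\<close>.\<close>

definition M_hom_qnorm ::
  "'a::metric_space measure \<Rightarrow> ('a \<Rightarrow> ereal) \<Rightarrow> ('a \<Rightarrow> ereal) \<Rightarrow> ('a \<Rightarrow> ereal) \<Rightarrow> ('a \<Rightarrow> ereal) \<Rightarrow> ennreal"
  where "M_hom_qnorm M s p q u = (INF g\<in>gradients M s u. Lp_lq_qnorm M p q g)"

definition N_hom_qnorm ::
  "'a::metric_space measure \<Rightarrow> ('a \<Rightarrow> ereal) \<Rightarrow> ('a \<Rightarrow> ereal) \<Rightarrow> ('a \<Rightarrow> ereal) \<Rightarrow> ('a \<Rightarrow> ereal) \<Rightarrow> ennreal"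
  where "N_hom_qnorm M s p q u = (INF g\<in>gradients M s u. lq_Lp_qnorm M p q g)"

text \<open>Elements of the function spaces are represented by functions rather than by classes
  modulo equality almost everywhere: all carriers and quasi-norms below are invariant
  under measurable changes on null sets.\<close>

record 'a qn_space =
  elems :: "('a \<Rightarrow> ereal) set"
  qnorm :: "('a \<Rightarrow> ereal) \<Rightarrow> ennreal"

definition Lp_space :: "'a measure \<Rightarrow> ('a \<Rightarrow> ereal) \<Rightarrow> 'a qn_space" where
  "Lp_space M p =
     \<lparr>elems = {u \<in> borel_measurable M. \<exists>l::real. 0 < l \<and> modular M p (\<lambda>x. ereal l * u x) < \<infinity>},
      qnorm = Lp_qnorm M p\<rparr>"

definition M_space ::
  "'a::metric_space measure \<Rightarrow> ('a \<Rightarrow> ereal) \<Rightarrow> ('a \<Rightarrow> ereal) \<Rightarrow> ('a \<Rightarrow> ereal) \<Rightarrow> 'a qn_space" where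
  "M_space M s p q =
     \<lparr>elems = {u \<in> elems (Lp_space M p). M_hom_qnorm M s p q u < \<infinity>},
      qnorm = (\<lambda>u. Lp_qnorm M p u + M_hom_qnorm M s p q u)\<rparr>"

definition N_space ::
  "'a::metric_space measure \<Rightarrow> ('a \<Rightarrow> ereal) \<Rightarrow> ('a \<Rightarrow> ereal) \<Rightarrow> ('a \<Rightarrow> ereal) \<Rightarrow> 'a qn_space" where
  "N_space M s p q =
     \<lparr>elems = {u \<in> elems (Lp_space M p). N_hom_qnorm M s p q u < \<infinity>},
      qnorm = (\<lambda>u. Lp_qnorm M p u + N_hom_qnorm M s p q u)\<rparr>"

definition qn_continuous_inclusion :: "'a qn_space \<Rightarrow> 'a qn_space \<Rightarrow> bool" where
  "qn_continuous_inclusion Y Z \<longleftrightarrow>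
     elems Y \<subseteq> elems Z \<and>
     (\<forall>u\<in>elems Y. \<forall>e>0. \<exists>d>0. \<forall>v\<in>elems Y.
        qnorm Y (\<lambda>x. v x - u x) < d \<longrightarrow> qnorm Z (\<lambda>x. v x - u x) < e)"

definition qn_bounded :: "'a qn_space \<Rightarrow> ('a \<Rightarrow> ereal) set \<Rightarrow> bool" where
  "qn_bounded Y B \<longleftrightarrow> B \<subseteq> elems Y \<and> (\<exists>C<\<infinity>. \<forall>u\<in>B. qnorm Y u \<le> C)"

definition qn_totally_bounded :: "'a qn_space \<Rightarrow> ('a \<Rightarrow> ereal) set \<Rightarrow> bool" where
  "qn_totally_bounded Z B \<longleftrightarrow>
     B \<subseteq> elems Z \<and>
     (\<forall>e>0. \<exists>F. finite F \<and> F \<subseteq> elems Z \<and> (\<forall>u\<in>B. \<exists>v\<in>F. qnorm Z (\<lambda>x. u x - v x) < e))"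

definition compactly_embedded :: "'a qn_space \<Rightarrow> 'a qn_space \<Rightarrow> bool"
    (infix \<open>\<hookrightarrow>\<hookrightarrow>\<close> 50) where
  "Y \<hookrightarrow>\<hookrightarrow> Z \<longleftrightarrow>
     qn_continuous_inclusion Y Z \<and> (\<forall>B. qn_bounded Y B \<longrightarrow> qn_totally_bounded Z B)"

end

theory Submission
  imports Defs
begin

text \<open>
  The equivalence rests on one interpolation inequality. If \<open>t \<lless> s\<close>, then for every
  \<open>e > 0\<close> there is a \<open>C\<close> such that both homogeneous quasi-norms of order \<open>t\<close> satisfy
  \<open>\<parallel>u\<parallel>\<^sub>t \<le> e \<parallel>u\<parallel>\<^sub>s + C \<parallel>u\<parallel>\<^sub>p\<close>, where \<open>\<parallel>u\<parallel>\<^sub>s\<close> is only the weak quasi-norm in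
  \<open>N\<^bsup>s(\<cdot>)\<^esup>\<^bsub>p(\<cdot>),\<infinity>\<^esub>\<close> (lemma \<open>hom_qnorm_interpolation\<close>). To see this, let \<open>g\<close> be an
  \<open>s\<close>-gradient of \<open>u\<close>. At distances about \<open>2\<^bsup>-k\<^esup>\<close> with large \<open>k\<close>, the surplus of smoothness
  turns \<open>g\<^sub>k\<close> into a \<open>t\<close>-gradient with a small and geometrically decaying factor; at all
  larger distances, multiples of \<open>\<bar>u\<bar>\<close> that decay geometrically as \<open>k\<close> tends to \<open>-\<infinity>\<close>
  serve as gradient (lemma \<open>gradients_change_smoothness\<close>). Geometric decay gives the
  same bound for every summability exponent \<open>r\<close> and for both orders of summation and
  integration: a sequence whose \<open>k\<close>-th member is bounded in \<open>L\<^bsup>p(\<cdot>)\<^esup>\<close> by a decaying weight is bounded in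
  both mixed spaces (lemmas \<open>Lp_lq_qnorm_le\<close> and \<open>lq_Lp_qnorm_le\<close>).

  Given (i), the inequality transfers nets from \<open>L\<^bsup>p(\<cdot>)\<^esup>\<close> to the spaces of order \<open>t\<close>, and
  also gives continuity of the inclusion; this is (ii). From (ii) to (iii) one takes
  \<open>t = s / 2\<close> and \<open>r = q\<close>. From (iii) to (i) one uses that the quasi-norms of order \<open>t\<close>
  dominate that of \<open>L\<^bsup>p(\<cdot>)\<^esup>\<close>.
\<close>

section \<open>Sums over the integers\<close>

lemma infsum_ennreal_leI:
  fixes f :: "'i \<Rightarrow> ennreal"
  assumes "\<And>F. finite F \<Longrightarrow> sum f F \<le> C"
  shows "infsum f UNIV \<le> C"
  by (subst nonneg_infsum_complete) (auto intro!: SUP_least assms)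

lemma infsum_ennreal_ge_term:
  fixes f :: "'i \<Rightarrow> ennreal"
  shows "f k \<le> infsum f UNIV"
proof (subst nonneg_infsum_complete)
  have "sum f {k} \<le> (SUP F\<in>{F. finite F \<and> F \<subseteq> UNIV}. sum f F)"
    by (rule SUP_upper) simp
  then show "f k \<le> (SUP F\<in>{F. finite F \<and> F \<subseteq> UNIV}. sum f F)" by simp
qed simp

lemma infsum_int_eq_suminf:
  fixes f :: "int \<Rightarrow> ennreal"
  shows "infsum f UNIV = (\<Sum>n. f (int_decode n))"
proof -
  have "infsum f UNIV = infsum (\<lambda>n. f (int_decode n)) UNIV"
    by (rule infsum_reindex_bij_betw[OF bij_int_decode, symmetric])
  also have "\<dots> = (\<Sum>n. f (int_decode n))"
    by (intro sums_unique has_sum_imp_sums has_sum_infsum nonneg_summable_on_complete) simp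
  finally show ?thesis .
qed

lemma nn_integral_infsum_int:
  fixes f :: "int \<Rightarrow> 'a \<Rightarrow> ennreal"
  assumes "\<And>k. f k \<in> borel_measurable M"
  shows "(\<integral>\<^sup>+x. infsum (\<lambda>k. f k x) UNIV \<partial>M) = infsum (\<lambda>k. \<integral>\<^sup>+x. f k x \<partial>M) UNIV"
  by (simp add: infsum_int_eq_suminf nn_integral_suminf assms)

lemma infsum_cmult_ennreal:
  fixes f :: "int \<Rightarrow> ennreal"
  shows "infsum (\<lambda>k. f k * c) UNIV = infsum f UNIV * c"
  by (simp add: infsum_int_eq_suminf)

text \<open>The weights \<open>\<eta> x\<^bsup>|k|\<^esup>\<close> carry the whole argument: they decay in both directions,
  so that scaling them by a small \<open>\<eta>\<close> makes their \<open>\<rho>\<close>-th powers sum to at most 1,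
  however small \<open>\<rho>\<close> is.\<close>

lemma geometric_int_scaled_sum:
  fixes x \<rho> :: real
  assumes x: "0 < x" "x < 1" and \<rho>: "0 < \<rho>"
  obtains \<eta> where "0 < \<eta>" "infsum (\<lambda>k::int. ennreal ((\<eta> * x powr \<bar>real_of_int k\<bar>) powr \<rho>)) UNIV \<le> 1"
proof -
  define y where "y = x powr \<rho>"
  have y: "0 < y" "y < 1"
    using x \<rho> powr_less_mono2[of \<rho> x 1] by (auto simp: y_def)
  define S where "S = 2 / (1 - y)"
  define \<eta> where "\<eta> = (1 / S) powr (1 / \<rho>)"
  have S: "0 < S" using y by (simp add: S_def)
  have \<eta>: "0 < \<eta>" "\<eta> powr \<rho> = 1 / S" using S \<rho> by (auto simp: \<eta>_def powr_powr)
  have pow: "(\<eta> * x powr \<bar>real_of_int k\<bar>) powr \<rho> = y ^ nat \<bar>k\<bar> / S" for k :: int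
  proof -
    have "(x powr \<bar>real_of_int k\<bar>) powr \<rho> = y powr real (nat \<bar>k\<bar>)"
      by (simp add: y_def powr_powr mult.commute)
    also have "\<dots> = y ^ nat \<bar>k\<bar>" using y(1) by (rule powr_realpow)
    finally show ?thesis using \<eta> by (simp add: powr_mult)
  qed
  have half: "(\<Sum>k\<in>F. y ^ nat \<bar>k\<bar>) \<le> 1 / (1 - y)" if "finite F" "inj_on (\<lambda>k. nat \<bar>k\<bar>) F" for F :: "int set"
  proof -
    have "(\<Sum>k\<in>F. y ^ nat \<bar>k\<bar>) = (\<Sum>n\<in>(\<lambda>k. nat \<bar>k\<bar>) ` F. y ^ n)"
      using that by (simp add: sum.reindex o_def)
    also have "\<dots> \<le> (\<Sum>n. y ^ n)"
      using that y by (intro sum_le_suminf summable_geometric) auto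
    also have "\<dots> = 1 / (1 - y)" using y by (simp add: suminf_geometric)
    finally show ?thesis .
  qed
  have "infsum (\<lambda>k::int. ennreal ((\<eta> * x powr \<bar>real_of_int k\<bar>) powr \<rho>)) UNIV \<le> 1"
  proof (rule infsum_ennreal_leI)
    fix F :: "int set" assume F: "finite F"
    have "(\<Sum>k\<in>F. y ^ nat \<bar>k\<bar>) = (\<Sum>k\<in>F \<inter> {0..}. y ^ nat \<bar>k\<bar>) + (\<Sum>k\<in>F - {0..}. y ^ nat \<bar>k\<bar>)"
      using F by (rule sum.Int_Diff)
    also have "\<dots> \<le> 1 / (1 - y) + 1 / (1 - y)"
      using F by (intro add_mono half) (auto simp: inj_on_def)
    finally have "(\<Sum>k\<in>F. y ^ nat \<bar>k\<bar>) \<le> S" by (simp add: S_def)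
    then have "(\<Sum>k\<in>F. y ^ nat \<bar>k\<bar> / S) \<le> 1"
      using S by (simp flip: sum_divide_distrib)
    then show "(\<Sum>k\<in>F. ennreal ((\<eta> * x powr \<bar>real_of_int k\<bar>) powr \<rho>)) \<le> 1"
      unfolding pow using S y by (subst sum_ennreal) auto
  qed
  with \<eta> show ?thesis using that by blast
qed

section \<open>Powers and modulars\<close>

lemma abs_powr_mono:
  assumes "\<bar>a\<bar> \<le> \<bar>b\<bar>" "0 \<le> r"
  shows "abs_powr a r \<le> abs_powr b r"
  using assms by (cases a; cases b) (auto simp: abs_powr_def intro!: ennreal_leI powr_mono2)

lemma abs_powr_scale:
  assumes "0 < c"
  shows "abs_powr (ereal c * a) r = ennreal (c powr r) * abs_powr a r"
  using assms
  by (cases a) (auto simp: abs_powr_def abs_mult powr_mult ennreal_mult ennreal_mult_top)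

lemma abs_powr_quasi_triangle:
  assumes "\<bar>w\<bar> \<le> \<bar>u\<bar> + \<bar>v\<bar>" "0 \<le> r"
  shows "abs_powr w r \<le> ennreal (2 powr r) * (abs_powr u r + abs_powr v r)"
proof -
  have *: "abs_powr w r \<le> ennreal (2 powr r) * abs_powr z r" if "\<bar>w\<bar> \<le> 2 * \<bar>z\<bar>" for z
  proof -
    have "abs_powr w r \<le> abs_powr (ereal 2 * z) r"
      using that assms(2) by (intro abs_powr_mono; cases w; cases z) (auto simp: abs_mult)
    then show ?thesis by (simp add: abs_powr_scale)
  qed
  have "\<bar>w\<bar> \<le> 2 * \<bar>u\<bar> \<or> \<bar>w\<bar> \<le> 2 * \<bar>v\<bar>"
    using assms(1) by (cases w; cases u; cases v) auto
  then show ?thesis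
  proof
    assume "\<bar>w\<bar> \<le> 2 * \<bar>u\<bar>"
    from *[OF this] show ?thesis
      by (rule order_trans) (intro mult_left_mono, auto)
  next
    assume "\<bar>w\<bar> \<le> 2 * \<bar>v\<bar>"
    from *[OF this] show ?thesis
      by (rule order_trans) (intro mult_left_mono, auto)
  qed
qed

lemma measurable_abs_powr [measurable]:
  assumes [measurable]: "f \<in> borel_measurable M" "p \<in> borel_measurable M"
  shows "(\<lambda>x. abs_powr (f x) (real_of_ereal (p x))) \<in> borel_measurable M"
  unfolding abs_powr_def by measurable

lemma modular_mono:
  assumes "AE x in M. \<bar>u x\<bar> \<le> \<bar>v x\<bar>" "\<And>x. x \<in> space M \<Longrightarrow> 0 \<le> p x"
  shows "modular M p u \<le> modular M p v"
proof -
  have "AE x in M. abs_powr (u x) (real_of_ereal (p x)) \<le> abs_powr (v x) (real_of_ereal (p x))"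
    using assms(1) AE_space
    by eventually_elim (auto intro!: abs_powr_mono real_of_ereal_pos assms(2))
  then show ?thesis unfolding modular_def by (rule nn_integral_mono_AE)
qed

section \<open>Mixed quasi-norms of weighted sequences\<close>

text \<open>The power \<open>\<rho>\<close> is half of a lower bound for the summability exponent \<open>r\<close>. Since weights
  are at most 1 and \<open>r / 2 \<ge> \<rho>\<close>, the \<open>r\<close>-th powers of their square roots still sum to at most
  1, for every finite \<open>r\<close> of this kind; for infinite \<open>r\<close> their supremum is at most 1. Hence the
  estimate is uniform in a variable exponent. The second factor \<open>sqrt (c k)\<close> of a weight is
  left for the outer norm.\<close>

lemma lq_qnorm_le_of_weighted_bound:
  fixes a :: "int \<Rightarrow> ereal" and c :: "int \<Rightarrow> real" and r :: ereal
  assumes c: "\<And>k. 0 < c k" "\<And>k. c k \<le> 1" "infsum (\<lambda>k. ennreal (c k powr \<rho>)) UNIV \<le> 1"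
    and \<rho>: "0 < \<rho>" "ereal (2 * \<rho>) \<le> r"
    and a: "\<And>k. \<bar>a k\<bar> \<le> ereal (sqrt (c k) * Y)" and Y: "0 \<le> Y"
  shows "0 \<le> lq_qnorm r a" "lq_qnorm r a \<le> ereal Y"
proof -
  have "0 \<le> lq_qnorm r a \<and> lq_qnorm r a \<le> ereal Y"
  proof (cases "r = \<infinity>")
    case True
    have "\<bar>a k\<bar> \<le> ereal Y" for k
    proof -
      have "sqrt (c k) * Y \<le> 1 * Y"
        using c(2) Y by (intro mult_right_mono) auto
      with a[of k] show ?thesis by (metis ereal_less_eq(3) mult_1 order_trans)
    qed
    then have "(SUP k. \<bar>a k\<bar>) \<le> ereal Y" by (auto intro: SUP_least)
    moreover have "0 \<le> (SUP k. \<bar>a k\<bar>)" by (rule SUP_upper2[of 0]) auto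
    ultimately show ?thesis using True by (simp add: lq_qnorm_def)
  next
    case False
    with \<rho> obtain R where R: "r = ereal R" "2 * \<rho> \<le> R" by (cases r) auto
    with \<rho> have R0: "0 < R" by simp
    define S where "S = infsum (\<lambda>k. abs_powr (a k) R) UNIV"
    have "abs_powr (a k) R \<le> ennreal (c k powr \<rho>) * ennreal (Y powr R)" for k
    proof -
      have "abs_powr (a k) R \<le> abs_powr (ereal (sqrt (c k) * Y)) R"
        using a[of k] c(1)[of k] Y R0 by (intro abs_powr_mono) auto
      also have "\<dots> = ennreal ((sqrt (c k) * Y) powr R)"
        using c(1)[of k] Y by (simp add: abs_powr_def less_imp_le)
      also have "(sqrt (c k) * Y) powr R = (c k powr (R / 2)) * Y powr R"
        using c(1)[of k] Y by (simp add: powr_mult powr_powr flip: powr_half_sqrt)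
      also have "ennreal \<dots> \<le> ennreal (c k powr \<rho> * Y powr R)"
        using c(1,2)[of k] R by (intro ennreal_leI mult_right_mono powr_mono') auto
      also have "\<dots> = ennreal (c k powr \<rho>) * ennreal (Y powr R)"
        by (simp add: ennreal_mult)
      finally show ?thesis .
    qed
    then have "S \<le> infsum (\<lambda>k. ennreal (c k powr \<rho>) * ennreal (Y powr R)) UNIV"
      unfolding S_def by (intro infsum_mono nonneg_summable_on_complete) auto
    also have "\<dots> \<le> 1 * ennreal (Y powr R)"
      unfolding infsum_cmult_ennreal by (intro mult_right_mono c(3)) auto
    finally have S: "S \<le> ennreal (Y powr R)" by simp
    have "abs_powr (enn2ereal S) (1 / R) \<le> abs_powr (ereal (Y powr R)) (1 / R)"
    proof (rule abs_powr_mono)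
      have "enn2ereal S \<le> enn2ereal (ennreal (Y powr R))"
        using S by (simp add: less_eq_ennreal.rep_eq)
      then show "\<bar>enn2ereal S\<bar> \<le> \<bar>ereal (Y powr R)\<bar>"
        by (simp add: enn2ereal_ennreal)
    qed (use R0 in simp)
    also have "\<dots> = ennreal Y"
      using Y R0 by (simp add: abs_powr_def powr_powr)
    finally have "enn2ereal (abs_powr (enn2ereal S) (1 / R)) \<le> enn2ereal (ennreal Y)"
      by (simp add: less_eq_ennreal.rep_eq)
    then have "enn2ereal (abs_powr (enn2ereal S) (1 / R)) \<le> ereal Y"
      using Y by (simp add: enn2ereal_ennreal)
    then show ?thesis
      by (simp add: lq_qnorm_def R S_def)
  qed
  then show "0 \<le> lq_qnorm r a" "lq_qnorm r a \<le> ereal Y" by auto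
qed

lemma summable_weight_le_1:
  fixes c :: "int \<Rightarrow> real"
  assumes "0 < c k" "infsum (\<lambda>k. ennreal (c k powr \<rho>)) UNIV \<le> 1" "0 < \<rho>"
  shows "c k \<le> 1"
proof (rule ccontr)
  assume "\<not> c k \<le> 1"
  then have "1 < c k powr \<rho>" using assms by (intro gr_one_powr) auto
  moreover have "ennreal (c k powr \<rho>) \<le> 1"
    using infsum_ennreal_ge_term[of "\<lambda>k. ennreal (c k powr \<rho>)" k] assms(2) by (rule order_trans)
  ultimately show False by simp
qed

text \<open>With \<open>E\<close> the right-hand side and \<open>Y = E\<^bsup>1/P\<^esup>\<close>, each single summand bounds
  \<open>|b k|\<close> by \<open>sqrt (c k) L Y\<close>, because \<open>P / 2 \<ge> \<rho>\<close>. The inner quasi-norm is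
  therefore at most \<open>L Y\<close>. In this way a sum of \<open>P\<close>-th powers replaces the triangle
  inequality, which fails for exponents below 1.\<close>

lemma lq_qnorm_powr_le_weighted_sum:
  fixes b :: "int \<Rightarrow> ereal" and c :: "int \<Rightarrow> real" and r :: ereal
  assumes c: "\<And>k. 0 < c k" "infsum (\<lambda>k. ennreal (c k powr \<rho>)) UNIV \<le> 1"
    and \<rho>: "0 < \<rho>" "ereal (2 * \<rho>) \<le> r" "2 * \<rho> \<le> P" and L: "0 < L"
  shows "abs_powr (lq_qnorm r b / ereal L) P
          \<le> infsum (\<lambda>k. ennreal (c k powr \<rho>) * abs_powr (b k / ereal (L * c k)) P) UNIV"
    (is "_ \<le> infsum ?f UNIV")
proof (cases "infsum ?f UNIV = \<infinity>")
  case False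
  then obtain E where E: "infsum ?f UNIV = ennreal E" "0 \<le> E"
    by (cases "infsum ?f UNIV") auto
  define Y where "Y = E powr (1 / P)"
  have P: "0 < P" using \<rho> by simp
  have c1: "c k \<le> 1" for k using summable_weight_le_1[of c k] c \<rho>(1) by blast
  have "\<bar>b k\<bar> \<le> ereal (sqrt (c k) * (L * Y))" for k
  proof -
    have ck: "0 < c k" "0 < L * c k" using c L by auto
    have f: "?f k \<le> ennreal E"
      using infsum_ennreal_ge_term[of ?f k] E by simp
    then have "?f k \<noteq> \<infinity>" by (auto simp: top_unique)
    then have "abs_powr (b k / ereal (L * c k)) P \<noteq> \<infinity>"
      using ck by (auto simp: ennreal_mult_eq_top_iff)
    then obtain z where z: "b k = ereal z"
      using ck L by (cases "b k") (auto simp: abs_powr_def)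
    define w where "w = \<bar>z\<bar> / (L * c k)"
    have w: "0 \<le> w" "\<bar>z\<bar> = L * c k * w" using ck by (auto simp: w_def)
    have "abs_powr (b k / ereal (L * c k)) P = ennreal (w powr P)"
      using ck L z by (simp add: abs_powr_def w_def)
    with f have *: "c k powr \<rho> * w powr P \<le> E"
      using E(2) by (simp add: ennreal_mult[symmetric])
    have "sqrt (c k) * w = ((sqrt (c k) * w) powr P) powr (1 / P)"
      using P ck w by (simp add: powr_powr)
    also have "(sqrt (c k) * w) powr P = c k powr (P / 2) * w powr P"
      using ck by (simp add: powr_mult powr_powr flip: powr_half_sqrt)
    also have "(c k powr (P / 2) * w powr P) powr (1 / P) \<le> Y"
      unfolding Y_def
    proof (rule powr_mono2)
      have "c k powr (P / 2) * w powr P \<le> c k powr \<rho> * w powr P"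
        using ck c1[of k] \<rho> by (intro mult_right_mono powr_mono') auto
      with * show "c k powr (P / 2) * w powr P \<le> E" by simp
    qed (use P in auto)
    finally have "(L * sqrt (c k)) * (sqrt (c k) * w) \<le> (L * sqrt (c k)) * Y"
      using ck L by (intro mult_left_mono) auto
    moreover have "(L * sqrt (c k)) * (sqrt (c k) * w) = L * c k * w"
      using ck by simp
    ultimately show ?thesis using w ck(1) by (simp add: z mult_ac)
  qed
  moreover have Y0: "0 \<le> Y" by (simp add: Y_def)
  moreover have "0 \<le> L * Y" using L Y0 by simp
  ultimately have lq: "0 \<le> lq_qnorm r b" "lq_qnorm r b \<le> ereal (L * Y)"
    using lq_qnorm_le_of_weighted_bound[of c \<rho> r b "L * Y"] c c1 \<rho> by blast+
  then have "\<bar>lq_qnorm r b / ereal L\<bar> \<le> \<bar>ereal Y\<bar>"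
    using L by (cases "lq_qnorm r b") (auto simp: field_simps abs_of_nonneg[OF Y0])
  then have "abs_powr (lq_qnorm r b / ereal L) P \<le> abs_powr (ereal Y) P"
    using P by (intro abs_powr_mono) auto
  also have "\<dots> = ennreal E"
    using P E by (simp add: abs_powr_def Y_def powr_powr)
  finally show ?thesis using E by simp
qed simp

text \<open>Members of size \<open>L c\<^sub>k\<close> in \<open>L\<^bsup>p(\<cdot>)\<^esup>\<close> form a sequence of size \<open>L\<close> in the mixed space,
  as soon as the \<open>\<rho>\<close>-th powers of the weights sum to at most 1: the pointwise estimate
  is integrated term by term.\<close>

lemma Lp_lq_qnorm_le:
  assumes p: "p \<in> borel_measurable M" "AE x in M. ereal (2 * \<rho>) \<le> p x \<and> p x < \<infinity>"
    and r: "AE x in M. ereal (2 * \<rho>) \<le> r x"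
    and h: "\<And>k. h k \<in> borel_measurable M" "\<And>k. modular M p (\<lambda>x. h k x / ereal (L * c k)) \<le> 1"
    and c: "\<And>k. 0 < c k" "infsum (\<lambda>k. ennreal (c k powr \<rho>)) UNIV \<le> 1"
    and \<rho>: "0 < \<rho>" and L: "0 < L"
  shows "Lp_lq_qnorm M p r h \<le> ennreal L"
proof -
  note [measurable] = p(1) h(1)
  let ?f = "\<lambda>k x. ennreal (c k powr \<rho>) * abs_powr (h k x / ereal (L * c k)) (real_of_ereal (p x))"
  have "AE x in M. abs_powr (lq_qnorm (r x) (\<lambda>k. h k x) / ereal L) (real_of_ereal (p x))
          \<le> infsum (\<lambda>k. ?f k x) UNIV"
    using p(2) r
  proof eventually_elim
    case (elim x)
    then obtain P where P: "p x = ereal P" by (cases "p x") auto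
    show ?case
      by (rule lq_qnorm_powr_le_weighted_sum) (use elim P c \<rho> L in auto)
  qed
  then have "modular M p (\<lambda>x. lq_qnorm (r x) (\<lambda>k. h k x) / ereal L)
      \<le> (\<integral>\<^sup>+x. infsum (\<lambda>k. ?f k x) UNIV \<partial>M)"
    unfolding modular_def by (rule nn_integral_mono_AE)
  also have "\<dots> = infsum (\<lambda>k. \<integral>\<^sup>+x. ?f k x \<partial>M) UNIV"
    by (rule nn_integral_infsum_int) measurable
  also have "\<dots> = infsum (\<lambda>k. ennreal (c k powr \<rho>) * modular M p (\<lambda>x. h k x / ereal (L * c k))) UNIV"
    unfolding modular_def by (subst nn_integral_cmult) measurable
  also have "\<dots> \<le> infsum (\<lambda>k. ennreal (c k powr \<rho>)) UNIV"
    using mult_left_mono[OF h(2), of "ennreal (c k powr \<rho>)" k for k]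
    by (intro infsum_mono nonneg_summable_on_complete) auto
  also note c(2)
  finally show ?thesis
    unfolding Lp_lq_qnorm_def Lp_qnorm_def using L by (intro INF_lower) auto
qed

text \<open>The analogue for the other mixed space. The number \<open>c\<^sub>k\<^bsup>\<rho>\<^esup>\<close> is admissible in the infimum
  that belongs to the index \<open>k\<close>, because \<open>\<rho> / r \<le> 1\<close> and \<open>c\<^sub>k \<le> 1\<close> give
  \<open>c\<^sub>k\<^bsup>\<rho>/r\<^esup> \<ge> c\<^sub>k\<close>.\<close>

lemma lq_Lp_qnorm_le:
  assumes p: "\<And>x. x \<in> space M \<Longrightarrow> 0 \<le> p x"
    and r: "AE x in M. ereal (2 * \<rho>) \<le> r x"
    and h: "\<And>k. modular M p (\<lambda>x. h k x / ereal (L * c k)) \<le> 1"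
    and c: "\<And>k. 0 < c k" "infsum (\<lambda>k. ennreal (c k powr \<rho>)) UNIV \<le> 1"
    and \<rho>: "0 < \<rho>" and L: "0 < L"
  shows "lq_Lp_qnorm M p r h \<le> ennreal L"
proof -
  have "modular M p (\<lambda>x. h k x / ereal L / ereal ((c k powr \<rho>) powr real_of_ereal (1 / r x))) \<le> 1" for k
  proof -
    have c1: "c k \<le> 1" using summable_weight_le_1[of c k] c \<rho> by blast
    have "AE x in M. \<bar>h k x / ereal L / ereal ((c k powr \<rho>) powr real_of_ereal (1 / r x))\<bar>
           \<le> \<bar>h k x / ereal (L * c k)\<bar>"
      using r
    proof eventually_elim
      case (elim x)
      define e where "e = \<rho> * real_of_ereal (1 / r x)"
      have "e \<le> 1"
        using elim \<rho> by (cases "r x") (auto simp: e_def one_ereal_def field_simps)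
      then have "c k powr 1 \<le> c k powr e" using c(1) c1 by (intro powr_mono') (auto simp: less_imp_le)
      then have le: "L * c k \<le> L * c k powr e" using c(1)[of k] L by simp
      have pos: "0 < L * c k" "0 < c k powr e" "0 < L * c k powr e" using c(1)[of k] L by auto
      have "\<bar>h k x / ereal L / ereal (c k powr e)\<bar> \<le> \<bar>h k x / ereal (L * c k)\<bar>"
      proof (cases "h k x")
        case (real z)
        have "\<bar>z\<bar> / (L * c k powr e) \<le> \<bar>z\<bar> / (L * c k)"
          using divide_left_mono[OF le _ mult_pos_pos[OF pos(3,1)], of "\<bar>z\<bar>"] by simp
        then show ?thesis using real pos L c(1)[of k] by (simp add: abs_mult)
      qed (use pos L c(1)[of k] in auto)
      then show ?case by (simp add: e_def powr_powr)
    qed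
    then have "modular M p (\<lambda>x. h k x / ereal L / ereal ((c k powr \<rho>) powr real_of_ereal (1 / r x)))
        \<le> modular M p (\<lambda>x. h k x / ereal (L * c k))"
      by (rule modular_mono) (rule p)
    with h show ?thesis by (meson order_trans)
  qed
  then have "lq_Lp_modular M p r (\<lambda>k x. h k x / ereal L) \<le> infsum (\<lambda>k. ennreal (c k powr \<rho>)) UNIV"
    unfolding lq_Lp_modular_def
    by (intro infsum_mono nonneg_summable_on_complete INF_lower)
       (auto simp: c(1)[THEN less_imp_neq, THEN not_sym])
  also note c(2)
  finally show ?thesis
    unfolding lq_Lp_qnorm_def using L by (intro INF_lower) auto
qed

section \<open>Bounds on exponents and the quasi-triangle inequality\<close>

lemma AE_ge_of_essinf_pos:
  assumes "0 < essinf M f"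
  obtains \<rho> :: real where "0 < \<rho>" "AE x in M. ereal \<rho> \<le> f x"
proof -
  obtain \<rho> where \<rho>: "0 < ereal \<rho>" "ereal \<rho> < essinf M f"
    using ereal_dense2[OF assms] by auto
  have "AE x in M. - f x \<le> esssup M (\<lambda>x. - f x)" by (rule esssup_AE)
  then have "AE x in M. ereal \<rho> \<le> f x"
  proof eventually_elim
    case (elim x)
    then have "essinf M f \<le> f x" by (simp add: essinf_def ereal_uminus_le_reorder)
    with \<rho> show ?case by simp
  qed
  with \<rho> that show thesis by auto
qed

lemma exponents_AE_ge:
  assumes "r \<in> exponents M"
  obtains \<rho> :: real where "0 < \<rho>" "AE x in M. ereal \<rho> \<le> r x"
  using assms AE_ge_of_essinf_pos[of M r] by (auto simp: exponents_def)

lemma bounded_exponents_AE_le: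
  assumes "p \<in> bounded_exponents M"
  obtains T :: real where "0 < T" "AE x in M. p x \<le> ereal T"
proof -
  have "max 0 (esssup M p) < \<infinity>" using assms by (auto simp: bounded_exponents_def max_def)
  from ereal_dense2[OF this] obtain T where T: "max 0 (esssup M p) < ereal T" by auto
  have "AE x in M. p x \<le> esssup M p" by (rule esssup_AE)
  then have "AE x in M. p x \<le> ereal T" by eventually_elim (use T in auto)
  with T that show thesis by auto
qed

lemma exponents_nonneg: "p \<in> exponents M \<Longrightarrow> x \<in> space M \<Longrightarrow> 0 \<le> p x"
  by (auto simp: exponents_def less_imp_le)

lemma abs_divide_ereal_antimono:
  assumes "0 < b" "b \<le> a"
  shows "\<bar>z / ereal a\<bar> \<le> \<bar>z / ereal b\<bar>"
proof (cases z)
  case (real y)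
  have "\<bar>y\<bar> / a \<le> \<bar>y\<bar> / b"
    using assms by (intro divide_left_mono) auto
  with real assms show ?thesis by simp
qed (use assms in auto)

lemma modular_le_1_of_Lp_qnorm_less:
  assumes "Lp_qnorm M p u < ennreal A" "\<And>x. x \<in> space M \<Longrightarrow> 0 \<le> p x"
  shows "modular M p (\<lambda>x. u x / ereal A) \<le> 1"
proof -
  obtain l where l: "0 < l" "modular M p (\<lambda>x. u x / ereal l) \<le> 1" "ennreal l < ennreal A"
    using assms(1) by (auto simp: Lp_qnorm_def INF_less_iff)
  then have "l \<le> A" by (simp add: ennreal_less_iff less_imp_le)
  with l have "modular M p (\<lambda>x. u x / ereal A) \<le> modular M p (\<lambda>x. u x / ereal l)"
    by (intro modular_mono assms(2)) (simp_all add: abs_divide_ereal_antimono)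
  with l show ?thesis by simp
qed

lemma Lp_qnorm_le:
  assumes "0 < A" "modular M p (\<lambda>x. u x / ereal A) \<le> 1"
  shows "Lp_qnorm M p u \<le> ennreal A"
  unfolding Lp_qnorm_def using assms by (intro INF_lower) auto

text \<open>Since \<open>|w|\<^sup>p \<le> 2\<^sup>p (|u|\<^sup>p + |v|\<^sup>p)\<close>, the modular of \<open>w / A\<close> is controlled by twice a power of 2;
  the constant \<open>2 \<cdot> 2\<^bsup>1/\<rho>\<^esup>\<close>, with \<open>\<rho>\<close> a positive lower bound of \<open>p\<close>, makes up for the
  power of 2 and for the two summands. The assumption on \<open>w\<close> is an inequality of absolute
  values, so that differences of infinite values need no separate treatment.\<close>

lemma modular_quasi_triangle:
  assumes "p \<in> bounded_exponents M"
  obtains \<kappa> where "0 < \<kappa>"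
    "\<And>u v w A. u \<in> borel_measurable M \<Longrightarrow> v \<in> borel_measurable M \<Longrightarrow>
       (\<And>x. \<bar>w x\<bar> \<le> \<bar>u x\<bar> + \<bar>v x\<bar>) \<Longrightarrow> 0 < A \<Longrightarrow>
       modular M p (\<lambda>x. u x / ereal A) \<le> 1 \<Longrightarrow> modular M p (\<lambda>x. v x / ereal A) \<le> 1 \<Longrightarrow>
       modular M p (\<lambda>x. w x / ereal (\<kappa> * A)) \<le> 1"
proof -
  have p: "p \<in> exponents M" and [measurable]: "p \<in> borel_measurable M"
    using assms by (auto simp: bounded_exponents_def exponents_def)
  obtain \<rho> where \<rho>: "0 < \<rho>" "AE x in M. ereal \<rho> \<le> p x"
    using exponents_AE_ge[OF p] .
  obtain T where T: "AE x in M. p x \<le> ereal T"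
    using bounded_exponents_AE_le[OF assms] .
  define \<kappa> where "\<kappa> = 2 * 2 powr (1 / \<rho>)"
  have \<kappa>: "0 < \<kappa>" by (simp add: \<kappa>_def)
  have "modular M p (\<lambda>x. w x / ereal (\<kappa> * A)) \<le> 1"
    if [measurable]: "u \<in> borel_measurable M" "v \<in> borel_measurable M"
      and w: "\<And>x. \<bar>w x\<bar> \<le> \<bar>u x\<bar> + \<bar>v x\<bar>" and A: "0 < A"
      and u: "modular M p (\<lambda>x. u x / ereal A) \<le> 1" and v: "modular M p (\<lambda>x. v x / ereal A) \<le> 1"
    for u v w A
  proof -
    let ?a = "\<lambda>u x. abs_powr (u x / ereal A) (real_of_ereal (p x))"
    have "AE x in M. abs_powr (w x / ereal (\<kappa> * A)) (real_of_ereal (p x))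
            \<le> ennreal (1 / 2) * (?a u x + ?a v x)"
      using \<rho>(2) T
    proof eventually_elim
      case (elim x)
      then obtain P where P: "p x = ereal P" "\<rho> \<le> P" by (cases "p x") auto
      have "w x / ereal (\<kappa> * A) = ereal (1 / \<kappa>) * (w x / ereal A)"
        using A \<kappa> by (cases "w x") auto
      then have "abs_powr (w x / ereal (\<kappa> * A)) P = ennreal ((1 / \<kappa>) powr P) * abs_powr (w x / ereal A) P"
        using \<kappa> by (simp add: abs_powr_scale)
      also have "\<dots> \<le> ennreal ((1 / \<kappa>) powr P) * (ennreal (2 powr P) * (?a u x + ?a v x))"
      proof (intro mult_left_mono)
        have "\<bar>w x / ereal A\<bar> \<le> \<bar>u x / ereal A\<bar> + \<bar>v x / ereal A\<bar>"
          using w[of x] A by (cases "w x"; cases "u x"; cases "v x") (auto simp: field_simps)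
        then show "abs_powr (w x / ereal A) P \<le> ennreal (2 powr P) * (?a u x + ?a v x)"
          using P \<rho> by (simp add: abs_powr_quasi_triangle)
      qed simp
      also have "\<dots> = ennreal ((2 / \<kappa>) powr P) * (?a u x + ?a v x)"
        using \<kappa> by (simp add: powr_divide mult.assoc[symmetric] ennreal_mult[symmetric])
      also have "\<dots> \<le> ennreal (1 / 2) * (?a u x + ?a v x)"
      proof (intro mult_right_mono ennreal_leI)
        have "(2 / \<kappa>) powr P = (1 / 2) powr (P / \<rho>)"
          by (simp add: \<kappa>_def powr_divide powr_powr)
        also have "\<dots> \<le> (1 / 2) powr 1"
          using P \<rho> by (intro powr_mono') auto
        finally show "(2 / \<kappa>) powr P \<le> 1 / 2" by simp
      qed simp
      finally show ?case by (simp add: P)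
    qed
    then have "modular M p (\<lambda>x. w x / ereal (\<kappa> * A)) \<le> (\<integral>\<^sup>+x. ennreal (1 / 2) * (?a u x + ?a v x) \<partial>M)"
      unfolding modular_def by (rule nn_integral_mono_AE)
    also have "\<dots> = ennreal (1 / 2) * (modular M p (\<lambda>x. u x / ereal A) + modular M p (\<lambda>x. v x / ereal A))"
      unfolding modular_def by (simp add: nn_integral_cmult nn_integral_add)
    also have "\<dots> \<le> ennreal (1 / 2) * (1 + 1)"
      by (intro mult_left_mono add_mono u v) auto
    also have "\<dots> = 1"
      using ennreal_mult[of "1 / 2" 2] by simp
    finally show ?thesis .
  qed
  with \<kappa> that show thesis by blast
qed

text \<open>A finite modular becomes at most 1 after shrinking the function, because the exponent is
  bounded away from 0.\<close>

lemma Lp_space_modular_le_1: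
  assumes p: "p \<in> bounded_exponents M" and u: "u \<in> elems (Lp_space M p)"
  obtains A where "0 < A" "modular M p (\<lambda>x. u x / ereal A) \<le> 1"
proof -
  have pe: "p \<in> exponents M" and [measurable]: "p \<in> borel_measurable M" "u \<in> borel_measurable M"
    using p u by (auto simp: bounded_exponents_def exponents_def Lp_space_def)
  obtain \<rho> where \<rho>: "0 < \<rho>" "AE x in M. ereal \<rho> \<le> p x"
    using exponents_AE_ge[OF pe] .
  obtain T where T: "AE x in M. p x \<le> ereal T"
    using bounded_exponents_AE_le[OF p] .
  obtain l where l: "0 < l" "modular M p (\<lambda>x. ereal l * u x) < \<infinity>"
    using u by (auto simp: Lp_space_def)
  then obtain V where V: "modular M p (\<lambda>x. ereal l * u x) = ennreal V" "0 \<le> V"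
    by (cases "modular M p (\<lambda>x. ereal l * u x)") auto
  define c where "c = (1 / (1 + V)) powr (1 / \<rho>)"
  have c: "0 < c" "c \<le> 1" using V \<rho> by (auto simp: c_def intro!: powr_le1)
  have cV: "c powr \<rho> * V \<le> 1" using V \<rho> by (simp add: c_def powr_powr)
  have "AE x in M. abs_powr (u x / ereal (1 / (c * l))) (real_of_ereal (p x))
          \<le> ennreal (c powr \<rho>) * abs_powr (ereal l * u x) (real_of_ereal (p x))"
    using \<rho>(2) T
  proof eventually_elim
    case (elim x)
    then obtain P where P: "p x = ereal P" "\<rho> \<le> P" by (cases "p x") auto
    have "u x / ereal (1 / (c * l)) = ereal c * (ereal l * u x)"
      using c l by (cases "u x") auto
    then have "abs_powr (u x / ereal (1 / (c * l))) P = ennreal (c powr P) * abs_powr (ereal l * u x) P"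
      using c by (simp add: abs_powr_scale)
    also have "\<dots> \<le> ennreal (c powr \<rho>) * abs_powr (ereal l * u x) P"
      using c P by (intro mult_right_mono ennreal_leI powr_mono') auto
    finally show ?case by (simp add: P)
  qed
  then have "modular M p (\<lambda>x. u x / ereal (1 / (c * l)))
      \<le> (\<integral>\<^sup>+x. ennreal (c powr \<rho>) * abs_powr (ereal l * u x) (real_of_ereal (p x)) \<partial>M)"
    unfolding modular_def by (rule nn_integral_mono_AE)
  also have "\<dots> = ennreal (c powr \<rho>) * ennreal V"
    unfolding V(1)[symmetric] modular_def by (rule nn_integral_cmult) measurable
  also have "\<dots> \<le> 1"
    using cV V by (simp add: ennreal_mult[symmetric])
  finally show thesis using that[of "1 / (c * l)"] c l by simp
qed

section \<open>Gradients that are uniformly bounded in \<open>L\<^bsup>p(\<cdot>)\<^esup>\<close>\<close>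

text \<open>A single gradient witnesses that the quasi-norm of \<open>u\<close> in
  \<open>N\<^bsup>s(\<cdot>)\<^esup>\<^bsub>p(\<cdot>),\<infinity>\<^esub>\<close> is at most \<open>G\<close>. Of a bound in
  \<open>N\<^bsup>s(\<cdot>)\<^esup>\<^bsub>p(\<cdot>),q(\<cdot>)\<^esub>\<close> the argument retains only this.\<close>

definition gradient_bound ::
  "'a::metric_space measure \<Rightarrow> ('a \<Rightarrow> ereal) \<Rightarrow> ('a \<Rightarrow> ereal) \<Rightarrow> ('a \<Rightarrow> ereal) \<Rightarrow> real \<Rightarrow> bool" where
  "gradient_bound M s p u G \<longleftrightarrow> (\<exists>g\<in>gradients M s u. \<forall>k. modular M p (\<lambda>x. g k x / ereal G) \<le> 1)"

text \<open>The embedding of \<open>\<ell>\<^bsup>q(\<cdot>)\<^esup>(L\<^bsup>p(\<cdot>)\<^esup>)\<close> into \<open>\<ell>\<^sup>\<infinity>(L\<^bsup>p(\<cdot>)\<^esup>)\<close>: a single summand of the modular is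
  below 2, hence some \<open>l < 2\<close> is admissible in its infimum, and \<open>l\<^bsup>1/q\<^esup>\<close> is bounded because
  \<open>q\<close> is bounded away from 0.\<close>

lemma gradient_bound_of_N_hom_qnorm_less:
  assumes q: "q \<in> exponents M" and p: "\<And>x. x \<in> space M \<Longrightarrow> 0 \<le> p x"
  obtains \<kappa> where "0 < \<kappa>"
    "\<And>u m. 0 < m \<Longrightarrow> N_hom_qnorm M s p q u < ennreal m \<Longrightarrow> gradient_bound M s p u (\<kappa> * m)"
proof -
  obtain \<rho> where \<rho>: "0 < \<rho>" "AE x in M. ereal \<rho> \<le> q x"
    using exponents_AE_ge[OF q] .
  define \<kappa> :: real where "\<kappa> = 2 powr (1 / \<rho>)"
  have "gradient_bound M s p u (\<kappa> * m)" if m: "N_hom_qnorm M s p q u < ennreal m" for u m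
  proof -
    obtain g where g: "g \<in> gradients M s u" "lq_Lp_qnorm M p q g < ennreal m"
      using m by (auto simp: N_hom_qnorm_def INF_less_iff)
    then obtain m' where m': "0 < m'" "lq_Lp_modular M p q (\<lambda>k x. g k x / ereal m') \<le> 1" "m' < m"
      by (auto simp: lq_Lp_qnorm_def INF_less_iff ennreal_less_iff)
    have "modular M p (\<lambda>x. g k x / ereal (\<kappa> * m)) \<le> 1" for k
    proof -
      let ?S = "{l::real. 0 < l \<and>
        modular M p (\<lambda>x. g k x / ereal m' / ereal (l powr real_of_ereal (1 / q x))) \<le> 1}"
      have "(INF l\<in>?S. ennreal l) \<le> lq_Lp_modular M p q (\<lambda>k x. g k x / ereal m')"
        unfolding lq_Lp_modular_def by (rule infsum_ennreal_ge_term)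
      also note m'(2)
      also have "(1::ennreal) < ennreal 2" by (simp flip: ennreal_1 add: ennreal_less_iff)
      finally obtain l where l: "0 < l" "l < 2"
        "modular M p (\<lambda>x. g k x / ereal m' / ereal (l powr real_of_ereal (1 / q x))) \<le> 1"
        by (auto simp: INF_less_iff ennreal_less_iff)
      have "AE x in M. \<bar>g k x / ereal (\<kappa> * m)\<bar>
              \<le> \<bar>g k x / ereal m' / ereal (l powr real_of_ereal (1 / q x))\<bar>"
        using \<rho>(2)
      proof eventually_elim
        case (elim x)
        define e where "e = real_of_ereal (1 / q x)"
        have e: "0 \<le> e" "e \<le> 1 / \<rho>"
          using elim \<rho>(1) by (cases "q x"; auto simp: e_def one_ereal_def field_simps)+
        have "l powr e \<le> 2 powr e" using l e by (intro powr_mono2) auto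
        also have "\<dots> \<le> \<kappa>" unfolding \<kappa>_def using e by (intro powr_mono) auto
        finally have "m' * l powr e \<le> m * \<kappa>" using m' by (intro mult_mono) auto
        moreover have "g k x / ereal m' / ereal (l powr e) = g k x / ereal (m' * l powr e)"
          using m' l by (cases "g k x") auto
        ultimately show ?case
          unfolding e_def[symmetric] using m' l
          by (auto simp: mult.commute intro!: abs_divide_ereal_antimono)
      qed
      then have "modular M p (\<lambda>x. g k x / ereal (\<kappa> * m))
          \<le> modular M p (\<lambda>x. g k x / ereal m' / ereal (l powr real_of_ereal (1 / q x)))"
        by (rule modular_mono) (rule p)
      with l show ?thesis by simp
    qed
    with g show ?thesis by (auto simp: gradient_bound_def)
  qed
  moreover have "0 < \<kappa>" by (simp add: \<kappa>_def)
  ultimately show thesis using that by blast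
qed

text \<open>In the extended reals, a difference with an infinite term has absolute value \<open>\<infinity>\<close>.
  The triangle inequality for \<open>\<bar>(u x - v x) - (u y - v y)\<bar>\<close> therefore holds
  at points with infinite values as well.\<close>

lemma gradients_diff:
  assumes g: "g \<in> gradients M s u" and h: "h \<in> gradients M s v"
  shows "(\<lambda>k x. g k x + h k x) \<in> gradients M s (\<lambda>x. u x - v x)"
proof -
  obtain N where N: "N \<in> null_sets M"
    "\<And>k x y. x \<notin> N \<Longrightarrow> y \<notin> N \<Longrightarrow> 2 powi (- k - 1) \<le> dist x y \<Longrightarrow> dist x y < 2 powi (- k) \<Longrightarrow>
        \<bar>u x - u y\<bar> \<le> ereal (dist x y powr real_of_ereal (s x)) * g k x
                    + ereal (dist x y powr real_of_ereal (s y)) * g k y"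
    using g by (auto simp: gradients_def)
  obtain N' where N': "N' \<in> null_sets M"
    "\<And>k x y. x \<notin> N' \<Longrightarrow> y \<notin> N' \<Longrightarrow> 2 powi (- k - 1) \<le> dist x y \<Longrightarrow> dist x y < 2 powi (- k) \<Longrightarrow>
        \<bar>v x - v y\<bar> \<le> ereal (dist x y powr real_of_ereal (s x)) * h k x
                    + ereal (dist x y powr real_of_ereal (s y)) * h k y"
    using h by (auto simp: gradients_def)
  have meas: "(\<lambda>x. g k x + h k x) \<in> borel_measurable M" for k
    using g h by (intro borel_measurable_ereal_add) (auto simp: gradients_def)
  have nonneg: "0 \<le> g k x" "0 \<le> h k x" for k x
    using g h by (auto simp: gradients_def)
  have "\<bar>(u x - v x) - (u y - v y)\<bar> \<le> ereal (dist x y powr real_of_ereal (s x)) * (g k x + h k x)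
        + ereal (dist x y powr real_of_ereal (s y)) * (g k y + h k y)"
    if "x \<notin> N \<union> N'" "y \<notin> N \<union> N'" "2 powi (- k - 1) \<le> dist x y" "dist x y < 2 powi (- k)" for k x y
  proof -
    have "\<bar>(u x - v x) - (u y - v y)\<bar> \<le> \<bar>u x - u y\<bar> + \<bar>v x - v y\<bar>"
      by (cases "u x"; cases "v x"; cases "u y"; cases "v y") auto
    also have "\<dots> \<le> (ereal (dist x y powr real_of_ereal (s x)) * g k x
                    + ereal (dist x y powr real_of_ereal (s y)) * g k y)
      + (ereal (dist x y powr real_of_ereal (s x)) * h k x
                    + ereal (dist x y powr real_of_ereal (s y)) * h k y)"
      using that by (intro add_mono N(2) N'(2)) auto
    also have "\<dots> = ereal (dist x y powr real_of_ereal (s x)) * (g k x + h k x)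
        + ereal (dist x y powr real_of_ereal (s y)) * (g k y + h k y)"
      using nonneg by (simp add: ereal_left_distrib ereal_right_distrib add_ac)
    finally show ?thesis .
  qed
  moreover have "N \<union> N' \<in> null_sets M" using N N' by auto
  ultimately show ?thesis
    using meas nonneg unfolding gradients_def by (auto intro!: bexI[of _ "N \<union> N'"])
qed

lemma gradient_bound_diff:
  assumes p: "p \<in> bounded_exponents M"
  obtains \<kappa> where "0 < \<kappa>"
    "\<And>u v G. 0 < G \<Longrightarrow> gradient_bound M s p u G \<Longrightarrow> gradient_bound M s p v G \<Longrightarrow>
       gradient_bound M s p (\<lambda>x. u x - v x) (\<kappa> * G)"
proof -
  obtain \<kappa> where \<kappa>: "0 < \<kappa>"
    "\<And>u v w A. u \<in> borel_measurable M \<Longrightarrow> v \<in> borel_measurable M \<Longrightarrow>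
       (\<And>x. \<bar>w x\<bar> \<le> \<bar>u x\<bar> + \<bar>v x\<bar>) \<Longrightarrow> 0 < A \<Longrightarrow>
       modular M p (\<lambda>x. u x / ereal A) \<le> 1 \<Longrightarrow> modular M p (\<lambda>x. v x / ereal A) \<le> 1 \<Longrightarrow>
       modular M p (\<lambda>x. w x / ereal (\<kappa> * A)) \<le> 1"
    using modular_quasi_triangle[OF p] by blast
  have "gradient_bound M s p (\<lambda>x. u x - v x) (\<kappa> * G)"
    if G: "0 < G" and u: "gradient_bound M s p u G" and v: "gradient_bound M s p v G" for u v G
  proof -
    obtain g h where g: "g \<in> gradients M s u" "\<And>k. modular M p (\<lambda>x. g k x / ereal G) \<le> 1"
      and h: "h \<in> gradients M s v" "\<And>k. modular M p (\<lambda>x. h k x / ereal G) \<le> 1"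
      using u v by (auto simp: gradient_bound_def)
    have "modular M p (\<lambda>x. (g k x + h k x) / ereal (\<kappa> * G)) \<le> 1" for k
    proof (rule \<kappa>(2)[OF _ _ _ G g(2) h(2)])
      show "\<bar>g k x + h k x\<bar> \<le> \<bar>g k x\<bar> + \<bar>h k x\<bar>" for x
        by (cases "g k x"; cases "h k x") auto
    qed (use g(1) h(1) in \<open>auto simp: gradients_def\<close>)
    with gradients_diff[OF g(1) h(1)] show ?thesis
      unfolding gradient_bound_def by (intro bexI[where x="\<lambda>k x. g k x + h k x"]) auto
  qed
  with \<kappa>(1) that show thesis by blast
qed

section \<open>Trading smoothness for smallness\<close>

lemma dist_powr_le_of_small_scale:
  fixes d S T :: real
  assumes d: "0 < d" "d < 2 powr - real_of_int k"
    and k: "int K \<le> k" and \<theta>: "0 < \<theta>" "2 * \<theta> \<le> S - T"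
  shows "d powr S \<le> d powr T * (2 powr (- \<theta> * K) * (2 powr - \<theta>) powr \<bar>real_of_int k\<bar>)"
proof -
  have k0: "0 \<le> real_of_int k" "real K \<le> real_of_int k" using k by linarith+
  have "2 powr - real_of_int k \<le> 2 powr 0" using k0 by (intro powr_mono) auto
  with d have d1: "d \<le> 1" by simp
  have "d powr (S - T) \<le> d powr (2 * \<theta>)" using d d1 \<theta> by (intro powr_mono') auto
  also have "\<dots> \<le> (2 powr - real_of_int k) powr (2 * \<theta>)" using d \<theta> by (intro powr_mono2) auto
  also have "\<dots> = 2 powr (- \<theta> * real_of_int k) * 2 powr (- \<theta> * real_of_int k)"
    by (simp add: powr_powr algebra_simps flip: powr_add)
  also have "\<dots> \<le> 2 powr (- \<theta> * K) * 2 powr (- \<theta> * real_of_int k)"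
    using k0 \<theta> by (intro mult_right_mono powr_mono) auto
  also have "2 powr (- \<theta> * real_of_int k) = (2 powr - \<theta>) powr \<bar>real_of_int k\<bar>"
    using k0 by (simp add: powr_powr)
  finally have "d powr T * d powr (S - T) \<le>
      d powr T * (2 powr (- \<theta> * K) * (2 powr - \<theta>) powr \<bar>real_of_int k\<bar>)"
    by (intro mult_left_mono) auto
  then show ?thesis by (simp flip: powr_add)
qed

lemma one_le_dist_powr_of_large_scale:
  fixes d \<tau> T :: real
  assumes d: "2 powr (- real_of_int k - 1) \<le> d" and k: "k < int K"
    and \<theta>: "0 < \<theta>" "\<theta> \<le> \<tau>" "\<tau> \<le> T"
  shows "1 \<le> d powr \<tau> * (2 powr ((2 * real K + 1) * T) * (2 powr - \<theta>) powr \<bar>real_of_int k\<bar>)"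
proof -
  have "0 \<le> (- real_of_int k - 1) * \<tau> + (2 * real K + 1) * T - \<theta> * \<bar>real_of_int k\<bar>"
  proof (cases "0 \<le> k")
    case True
    then have k0: "0 \<le> real_of_int k" "real_of_int k + 1 \<le> real K" using k by linarith+
    have "(real_of_int k + 1) * \<tau> \<le> real K * T" using k0 \<theta> by (intro mult_mono) auto
    moreover have "\<theta> * real_of_int k \<le> T * real K" using k0 \<theta> by (intro mult_mono) auto
    ultimately show ?thesis using k0 \<theta> by (simp add: algebra_simps)
  next
    case False
    then have k0: "real_of_int k < 0" by simp
    then have "real_of_int k * \<tau> \<le> real_of_int k * \<theta>" using \<theta> by (intro mult_left_mono_neg) auto
    moreover have "0 \<le> real K * T" using \<theta> by simp
    moreover have "(- real_of_int k - 1) * \<tau> + (2 * real K + 1) * T - \<theta> * \<bar>real_of_int k\<bar>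
        = (real_of_int k * \<theta> - real_of_int k * \<tau>) + 2 * (real K * T) + (T - \<tau>)"
      using k0 by (simp add: algebra_simps)
    ultimately show ?thesis using \<theta> by linarith
  qed
  then have "(2::real) powr 0 \<le> 2 powr ((- real_of_int k - 1) * \<tau> + (2 * real K + 1) * T - \<theta> * \<bar>real_of_int k\<bar>)"
    by (intro powr_mono) auto
  also have "\<dots> = (2 powr (- real_of_int k - 1)) powr \<tau> *
      (2 powr ((2 * real K + 1) * T) * (2 powr - \<theta>) powr \<bar>real_of_int k\<bar>)"
    unfolding powr_powr powr_add[symmetric] by (simp add: algebra_simps)
  also have "\<dots> \<le> d powr \<tau> * (2 powr ((2 * real K + 1) * T) * (2 powr - \<theta>) powr \<bar>real_of_int k\<bar>)"
    using d \<theta> by (intro mult_right_mono powr_mono2) auto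
  finally show ?thesis by simp
qed

text \<open>A gradient for the lower smoothness \<open>t\<close>. At distances below \<open>2\<^bsup>-K\<^esup>\<close> the surplus
  \<open>s - t \<ge> 2 \<theta>\<close> yields a factor \<open>2\<^bsup>-2\<theta>k\<^esup>\<close>: one half of it is the small constant
  \<open>2\<^bsup>-\<theta>K\<^esup>\<close> in front of the old gradient, the other half is the decaying weight. At larger
  distances \<open>|u|\<close> itself serves, with a large constant and a weight that decays because
  \<open>t \<ge> \<theta>\<close>. Both parts are given the same weight \<open>2\<^bsup>-\<theta>|k|\<^esup>\<close>.\<close>

lemma gradients_change_smoothness:
  fixes M :: "'a::metric_space measure"
  assumes univ: "space M = UNIV"
    and ae: "AE x in M. ereal \<theta> \<le> t x \<and> t x \<le> ereal T \<and> \<bar>s x\<bar> \<noteq> \<infinity> \<and> ereal (2 * \<theta>) \<le> s x - t x"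
    and \<theta>: "0 < \<theta>" and u: "u \<in> borel_measurable M" and g: "g \<in> gradients M s u"
  shows "(\<lambda>k x. if int K \<le> k
            then ereal (2 powr (- \<theta> * K) * (2 powr - \<theta>) powr \<bar>real_of_int k\<bar>) * g k x
            else ereal (2 powr ((2 * real K + 1) * T) * (2 powr - \<theta>) powr \<bar>real_of_int k\<bar>) * \<bar>u x\<bar>)
          \<in> gradients M t u"
    (is "?h \<in> _")
proof -
  obtain N where N: "N \<in> null_sets M"
    "\<And>k x y. x \<notin> N \<Longrightarrow> y \<notin> N \<Longrightarrow> 2 powi (- k - 1) \<le> dist x y \<Longrightarrow> dist x y < 2 powi (- k) \<Longrightarrow>
        \<bar>u x - u y\<bar> \<le> ereal (dist x y powr real_of_ereal (s x)) * g k x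
                    + ereal (dist x y powr real_of_ereal (s y)) * g k y"
    using g by (auto simp: gradients_def)
  obtain N' where N': "N' \<in> null_sets M"
    "\<And>x. x \<notin> N' \<Longrightarrow> ereal \<theta> \<le> t x \<and> t x \<le> ereal T \<and> \<bar>s x\<bar> \<noteq> \<infinity> \<and> ereal (2 * \<theta>) \<le> s x - t x"
    using AE_E3[OF ae] univ by (metis DiffI UNIV_I)
  have real: "\<theta> \<le> real_of_ereal (t x)" "real_of_ereal (t x) \<le> T"
    "2 * \<theta> \<le> real_of_ereal (s x) - real_of_ereal (t x)" if "x \<notin> N'" for x
    using N'(2)[OF that] by (cases "t x"; cases "s x"; auto)+
  have g0: "0 \<le> g k x" for k x using g by (auto simp: gradients_def)
  have gm: "g k \<in> borel_measurable M" for k using g by (auto simp: gradients_def)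
  have "\<bar>u x - u y\<bar> \<le> ereal (dist x y powr real_of_ereal (t x)) * ?h k x
                    + ereal (dist x y powr real_of_ereal (t y)) * ?h k y"
    if xy: "x \<notin> N \<union> N'" "y \<notin> N \<union> N'" and d: "2 powi (- k - 1) \<le> dist x y" "dist x y < 2 powi (- k)" for k x y
  proof -
    have d': "2 powr (- real_of_int k - 1) \<le> dist x y" "dist x y < 2 powr - real_of_int k"
      using d powr_real_of_int'[of 2 "- k - 1"] powr_real_of_int'[of 2 "- k"] by auto
    have "(0::real) < 2 powr (- real_of_int k - 1)" by simp
    with d' have d0: "0 < dist x y" by linarith
    show ?thesis
    proof (cases "int K \<le> k")
      case True
      have *: "ereal (dist x y powr real_of_ereal (s z)) * g k z
          \<le> ereal (dist x y powr real_of_ereal (t z)) * ?h k z" if "z \<notin> N'" for z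
      proof -
        have "ereal (dist x y powr real_of_ereal (s z)) * g k z
            \<le> ereal (dist x y powr real_of_ereal (t z) *
                (2 powr (- \<theta> * K) * (2 powr - \<theta>) powr \<bar>real_of_int k\<bar>)) * g k z"
          using dist_powr_le_of_small_scale[OF d0 d'(2) True \<theta> real(3)[OF that]]
          by (intro ereal_mult_right_mono g0) simp
        also have "\<dots> = ereal (dist x y powr real_of_ereal (t z)) * ?h k z"
          using True by (simp add: mult.assoc flip: times_ereal.simps(1))
        finally show ?thesis .
      qed
      have "\<bar>u x - u y\<bar> \<le> ereal (dist x y powr real_of_ereal (s x)) * g k x
                    + ereal (dist x y powr real_of_ereal (s y)) * g k y"
        using N(2) xy d by auto
      also have "\<dots> \<le> ereal (dist x y powr real_of_ereal (t x)) * ?h k x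
                    + ereal (dist x y powr real_of_ereal (t y)) * ?h k y"
        using xy by (intro add_mono *) auto
      finally show ?thesis .
    next
      case False
      have *: "\<bar>u z\<bar> \<le> ereal (dist x y powr real_of_ereal (t z)) * ?h k z" if "z \<notin> N'" for z
      proof -
        have "ereal 1 * \<bar>u z\<bar>
            \<le> ereal (dist x y powr real_of_ereal (t z) *
                (2 powr ((2 * real K + 1) * T) * (2 powr - \<theta>) powr \<bar>real_of_int k\<bar>)) * \<bar>u z\<bar>"
          using one_le_dist_powr_of_large_scale[OF d'(1), of K \<theta>] False \<theta> real(1,2)[OF that]
          by (intro ereal_mult_right_mono) simp_all
        also have "\<dots> = ereal (dist x y powr real_of_ereal (t z)) * ?h k z"
          using False by (simp add: mult.assoc flip: times_ereal.simps(1))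
        finally show ?thesis by simp
      qed
      have "\<bar>u x - u y\<bar> \<le> \<bar>u x\<bar> + \<bar>u y\<bar>"
        by (cases "u x"; cases "u y") auto
      also have "\<dots> \<le> ereal (dist x y powr real_of_ereal (t x)) * ?h k x
                    + ereal (dist x y powr real_of_ereal (t y)) * ?h k y"
        using xy by (intro add_mono *) auto
      finally show ?thesis .
    qed
  qed
  note grad = this
  have null: "N \<union> N' \<in> null_sets M" using N N' by auto
  have meas: "?h k \<in> borel_measurable M" for k
    using u gm[of k]
    by (cases "int K \<le> k") (auto intro!: borel_measurable_ereal_times borel_measurable_ereal_abs)
  have nonneg: "0 \<le> ?h k x" for k x using g0 by simp
  show ?thesis
    unfolding gradients_def mem_Collect_eq
  proof (intro conjI allI bexI[OF _ null] ballI impI, goal_cases)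
    case (1 k) show ?case by (rule meas)
  next
    case (2 k x) show ?case by (rule nonneg)
  next
    case (3 k x y) then show ?case by (intro grad) auto
  qed
qed

text \<open>The interpolation inequality behind the theorem: up to an arbitrarily small multiple of the
  smoothness quasi-norm of order \<open>s\<close>, the smoothness of order \<open>t\<close> is controlled by the
  \<open>L\<^bsup>p(\<cdot>)\<^esup>\<close> quasi-norm.\<close>

lemma hom_qnorm_interpolation:
  fixes M :: "'a::metric_space measure"
  assumes M: "metric_measure_space M" and p: "p \<in> bounded_exponents M"
    and s: "s \<in> bounded_exponents M" and t: "t \<in> bounded_exponents M"
    and ts: "exponent_ll M t s" and r: "r \<in> exponents M" and e: "0 < e"
  obtains C where "0 < C"
    "\<And>u G A. u \<in> borel_measurable M \<Longrightarrow> 0 < G \<Longrightarrow> 0 < A \<Longrightarrow> gradient_bound M s p u G \<Longrightarrow>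
       modular M p (\<lambda>x. u x / ereal A) \<le> 1 \<Longrightarrow>
       M_hom_qnorm M t p r u \<le> ennreal (e * G + C * A) \<and>
       N_hom_qnorm M t p r u \<le> ennreal (e * G + C * A)"
proof -
  have univ: "space M = UNIV"
    using M sets_eq_imp_space_eq[of M borel] by (simp add: metric_measure_space_def)
  have ex: "p \<in> exponents M" "t \<in> exponents M" "s \<in> exponents M"
    and pm: "p \<in> borel_measurable M"
    using p t s by (auto simp: bounded_exponents_def exponents_def)
  obtain \<rho>\<^sub>p where \<rho>p: "0 < \<rho>\<^sub>p" "AE x in M. ereal \<rho>\<^sub>p \<le> p x" using exponents_AE_ge[OF ex(1)] .
  obtain \<rho>\<^sub>r where \<rho>r: "0 < \<rho>\<^sub>r" "AE x in M. ereal \<rho>\<^sub>r \<le> r x" using exponents_AE_ge[OF r] .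
  obtain \<tau> where \<tau>: "0 < \<tau>" "AE x in M. ereal \<tau> \<le> t x" using exponents_AE_ge[OF ex(2)] .
  obtain \<sigma> where \<sigma>: "0 < \<sigma>" "AE x in M. ereal \<sigma> \<le> s x - t x"
    using AE_ge_of_essinf_pos ts unfolding exponent_ll_def by blast
  obtain P where P: "AE x in M. p x \<le> ereal P" using bounded_exponents_AE_le[OF p] .
  obtain T where T: "AE x in M. t x \<le> ereal T" using bounded_exponents_AE_le[OF t] .
  obtain S where S: "AE x in M. s x \<le> ereal S" using bounded_exponents_AE_le[OF s] .
  define \<rho> where "\<rho> = min \<rho>\<^sub>p \<rho>\<^sub>r / 2"
  define \<theta> where "\<theta> = min \<tau> (\<sigma> / 2)"
  have \<rho>: "0 < \<rho>" "2 * \<rho> \<le> \<rho>\<^sub>p" "2 * \<rho> \<le> \<rho>\<^sub>r" using \<rho>p \<rho>r by (auto simp: \<rho>_def)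
  have \<theta>: "0 < \<theta>" "\<theta> \<le> \<tau>" "2 * \<theta> \<le> \<sigma>" using \<tau> \<sigma> by (auto simp: \<theta>_def)
  have aep: "AE x in M. ereal (2 * \<rho>) \<le> p x \<and> p x < \<infinity>"
    using \<rho>p(2) P
  proof eventually_elim
    case (elim x)
    then show ?case using \<rho> by (cases "p x") auto
  qed
  have aer: "AE x in M. ereal (2 * \<rho>) \<le> r x"
    using \<rho>r(2)
  proof eventually_elim
    case (elim x)
    then show ?case using \<rho> by (cases "r x") auto
  qed
  have aes: "AE x in M. ereal \<theta> \<le> t x \<and> t x \<le> ereal T \<and> \<bar>s x\<bar> \<noteq> \<infinity> \<and> ereal (2 * \<theta>) \<le> s x - t x"
    using \<tau>(2) \<sigma>(2) T S AE_space
  proof eventually_elim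
    case (elim x)
    then show ?case using \<theta> exponents_nonneg[OF ex(3), of x]
      by (cases "t x"; cases "s x") auto
  qed
  define b where "b = (2::real) powr - \<theta>"
  have b: "0 < b" "b < 1" using \<theta> by (auto simp: b_def powr_less_one)
  obtain \<eta> where \<eta>: "0 < \<eta>" "infsum (\<lambda>k::int. ennreal ((\<eta> * b powr \<bar>real_of_int k\<bar>) powr \<rho>)) UNIV \<le> 1"
    using geometric_int_scaled_sum[OF b \<rho>(1)] .
  (* K makes the coefficient of the old gradient at most e times the weight c k; once K is
     fixed, C absorbs the constant D in front of \<bar>u\<bar>. *)
  obtain K where K: "b ^ K < e * \<eta>"
    using real_arch_pow_inv[OF _ b(2), of "e * \<eta>"] e \<eta> by auto
  have bK: "2 powr - (\<theta> * real K) = b ^ K"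
    by (simp add: b_def powr_powr flip: powr_realpow)
  define D where "D = (2::real) powr ((2 * real K + 1) * T)"
  define C where "C = D / \<eta>"
  define c where "c k = \<eta> * b powr \<bar>real_of_int k\<bar>" for k
  have D: "0 < D" by (simp add: D_def)
  then have C: "0 < C" using \<eta> by (simp add: C_def)
  have c: "0 < c k" for k using \<eta> b by (simp add: c_def)
  have cs: "infsum (\<lambda>k. ennreal (c k powr \<rho>)) UNIV \<le> 1" using \<eta> by (simp add: c_def)
  have "M_hom_qnorm M t p r u \<le> ennreal (e * G + C * A) \<and> N_hom_qnorm M t p r u \<le> ennreal (e * G + C * A)"
    if u: "u \<in> borel_measurable M" and G: "0 < G" and A: "0 < A" and gb: "gradient_bound M s p u G"
      and uA: "modular M p (\<lambda>x. u x / ereal A) \<le> 1" for u G A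
  proof -
    define L where "L = e * G + C * A"
    have L: "0 < L" "e * G \<le> L" "C * A \<le> L" using e G C A by (auto simp: L_def add_pos_pos)
    obtain g where g: "g \<in> gradients M s u" "\<And>k. modular M p (\<lambda>x. g k x / ereal G) \<le> 1"
      using gb by (auto simp: gradient_bound_def)
    define h where "h = (\<lambda>k x. if int K \<le> k
            then ereal (2 powr (- \<theta> * K) * (2 powr - \<theta>) powr \<bar>real_of_int k\<bar>) * g k x
            else ereal (2 powr ((2 * real K + 1) * T) * (2 powr - \<theta>) powr \<bar>real_of_int k\<bar>) * \<bar>u x\<bar>)"
    have h: "h \<in> gradients M t u"
      unfolding h_def by (rule gradients_change_smoothness[OF univ aes \<theta>(1) u g(1)])
    then have hm: "h k \<in> borel_measurable M" for k by (auto simp: gradients_def)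
    have scale: "\<bar>ereal (a * b powr \<bar>real_of_int k\<bar>) * z / ereal (L * c k)\<bar> \<le> \<bar>z / ereal H\<bar>"
      if "0 < a" "0 < H" "a * H \<le> L * \<eta>" for a H z k
    proof -
      have "ereal (a * b powr \<bar>real_of_int k\<bar>) * z / ereal (L * c k) = z / ereal (L * \<eta> / a)"
        using that L \<eta> b by (cases z) (auto simp: c_def field_simps)
      also have "\<bar>\<dots>\<bar> \<le> \<bar>z / ereal H\<bar>"
        using that by (intro abs_divide_ereal_antimono) (auto simp: field_simps)
      finally show ?thesis .
    qed
    have "modular M p (\<lambda>x. h k x / ereal (L * c k)) \<le> 1" for k
    proof (cases "int K \<le> k")
      case True
      have "b ^ K * G \<le> (e * \<eta>) * G" using K G by simp
      also have "\<dots> \<le> L * \<eta>" using L(2) \<eta> by (simp add: mult.commute mult.left_commute)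
      finally have "modular M p (\<lambda>x. h k x / ereal (L * c k)) \<le> modular M p (\<lambda>x. g k x / ereal G)"
        using True scale[of "b ^ K" G k] b G
        by (intro modular_mono exponents_nonneg[OF ex(1)]) (simp_all add: h_def bK flip: b_def)
      also note g(2)
      finally show ?thesis .
    next
      case False
      have "D * A \<le> L * \<eta>" using L(3) \<eta> by (simp add: C_def field_simps)
      then have "modular M p (\<lambda>x. h k x / ereal (L * c k)) \<le> modular M p (\<lambda>x. \<bar>u x\<bar> / ereal A)"
        using False scale[of D A k "\<bar>u x\<bar>" for x] D A
        by (intro modular_mono exponents_nonneg[OF ex(1)]) (simp_all add: h_def flip: b_def D_def)
      also have "\<dots> \<le> modular M p (\<lambda>x. u x / ereal A)"
      proof (intro modular_mono exponents_nonneg[OF ex(1)] AE_I2)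
        show "\<bar>\<bar>u x\<bar> / ereal A\<bar> \<le> \<bar>u x / ereal A\<bar>" for x
          using A by (cases "u x") auto
      qed
      finally show ?thesis using uA by simp
    qed
    note h_small = this
    have "Lp_lq_qnorm M p r h \<le> ennreal L"
      by (rule Lp_lq_qnorm_le[where h=h and c=c, OF pm aep aer hm h_small c cs \<rho>(1) L(1)])
    moreover have "lq_Lp_qnorm M p r h \<le> ennreal L"
      by (rule lq_Lp_qnorm_le[where p=p and h=h and c=c,
            OF exponents_nonneg[OF ex(1)] aer h_small c cs \<rho>(1) L(1)])
    ultimately show ?thesis using h
      unfolding M_hom_qnorm_def N_hom_qnorm_def L_def by (auto intro: INF_lower2)
  qed
  then show thesis by (rule that[OF C])
qed

section \<open>Compact embeddings\<close>

text \<open>Total boundedness is inherited from \<open>L\<^bsup>p(\<cdot>)\<^esup>\<close>: the differences of members of a bounded set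
  have bounded gradients, so the interpolation inequality makes \<open>H\<close> small on those differences
  that are small in \<open>L\<^bsup>p(\<cdot>)\<^esup>\<close>. The functional \<open>H\<close> stands for either homogeneous
  quasi-norm of order \<open>t\<close>.\<close>

lemma compactly_embedded_of_interpolation:
  fixes M :: "'a::metric_space measure"
  assumes p: "p \<in> bounded_exponents M" and q: "q \<in> exponents M"
    and compact: "N_space M s p q \<hookrightarrow>\<hookrightarrow> Lp_space M p"
    and Z: "elems Z = {u \<in> elems (Lp_space M p). H u < \<infinity>}" "qnorm Z = (\<lambda>u. Lp_qnorm M p u + H u)"
    and interp: "\<And>e::real. 0 < e \<Longrightarrow> \<exists>C>0. \<forall>u G A. u \<in> borel_measurable M \<longrightarrow> 0 < G \<longrightarrow> 0 < A \<longrightarrow>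
       gradient_bound M s p u G \<longrightarrow> modular M p (\<lambda>x. u x / ereal A) \<le> 1 \<longrightarrow>
       H u \<le> ennreal (e * G + C * A)"
  shows "N_space M s p q \<hookrightarrow>\<hookrightarrow> Z"
proof -
  have pe: "p \<in> exponents M" using p by (simp add: bounded_exponents_def)
  obtain \<kappa>\<^sub>q where \<kappa>q: "0 < \<kappa>\<^sub>q"
    "\<And>u m. 0 < m \<Longrightarrow> N_hom_qnorm M s p q u < ennreal m \<Longrightarrow> gradient_bound M s p u (\<kappa>\<^sub>q * m)"
    using gradient_bound_of_N_hom_qnorm_less[where s=s and p=p, OF q exponents_nonneg[OF pe]] by blast
  obtain \<kappa>\<^sub>p where \<kappa>p: "0 < \<kappa>\<^sub>p"
    "\<And>u v w A. u \<in> borel_measurable M \<Longrightarrow> v \<in> borel_measurable M \<Longrightarrow>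
       (\<And>x. \<bar>w x\<bar> \<le> \<bar>u x\<bar> + \<bar>v x\<bar>) \<Longrightarrow> 0 < A \<Longrightarrow>
       modular M p (\<lambda>x. u x / ereal A) \<le> 1 \<Longrightarrow> modular M p (\<lambda>x. v x / ereal A) \<le> 1 \<Longrightarrow>
       modular M p (\<lambda>x. w x / ereal (\<kappa>\<^sub>p * A)) \<le> 1"
    using modular_quasi_triangle[OF p] by blast
  obtain \<kappa>\<^sub>d where \<kappa>d: "0 < \<kappa>\<^sub>d"
    "\<And>u v G. 0 < G \<Longrightarrow> gradient_bound M s p u G \<Longrightarrow> gradient_bound M s p v G \<Longrightarrow>
       gradient_bound M s p (\<lambda>x. u x - v x) (\<kappa>\<^sub>d * G)"
    using gradient_bound_diff[where s=s, OF p] by blast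
  have meas: "u \<in> borel_measurable M" if "u \<in> elems (Lp_space M p)" for u
    using that by (simp add: Lp_space_def)
  have sub: "elems (N_space M s p q) \<subseteq> elems Z"
  proof
    fix u assume u: "u \<in> elems (N_space M s p q)"
    then have uL: "u \<in> elems (Lp_space M p)" and uN: "N_hom_qnorm M s p q u < \<infinity>"
      by (auto simp: N_space_def)
    obtain A where A: "0 < A" "modular M p (\<lambda>x. u x / ereal A) \<le> 1"
      using Lp_space_modular_le_1[OF p uL] .
    obtain m where m: "0 < m" "N_hom_qnorm M s p q u < ennreal m"
    proof -
      obtain v where v: "N_hom_qnorm M s p q u = ennreal v" "0 \<le> v"
        using uN by (cases "N_hom_qnorm M s p q u") auto
      with that[of "v + 1"] show thesis by (simp add: ennreal_less_iff)
    qed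
    obtain C where "H u \<le> ennreal (1 * (\<kappa>\<^sub>q * m) + C * A)"
      using interp[of 1] \<kappa>q(2)[OF m] \<kappa>q(1) m(1) A meas[OF uL] by (metis mult_pos_pos zero_less_one)
    then have "H u < \<infinity>" by (simp add: le_less_trans)
    with uL show "u \<in> elems Z" by (simp add: Z)
  qed
  have small: "\<exists>\<epsilon>>0. ennreal \<epsilon> < e" if e: "0 < (e::ennreal)" for e
  proof -
    obtain x where x: "0 < x" "x < e" using dense[OF e] by auto
    then obtain v where "x = ennreal v" "0 \<le> v" by (cases x) (auto simp: top.not_eq_extremum)
    with x show ?thesis by (intro exI[of _ v]) auto
  qed
  have cont: "\<exists>d>0. \<forall>v\<in>elems (N_space M s p q).
      qnorm (N_space M s p q) (\<lambda>x. v x - u x) < d \<longrightarrow> qnorm Z (\<lambda>x. v x - u x) < e"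
    if u: "u \<in> elems (N_space M s p q)" and e: "0 < e" for u e
  proof -
    obtain \<epsilon> where \<epsilon>: "0 < \<epsilon>" "ennreal \<epsilon> < e" using small[OF e] by blast
    obtain C where C: "0 < C" "\<And>u G A. u \<in> borel_measurable M \<Longrightarrow> 0 < G \<Longrightarrow> 0 < A \<Longrightarrow>
       gradient_bound M s p u G \<Longrightarrow> modular M p (\<lambda>x. u x / ereal A) \<le> 1 \<Longrightarrow>
       H u \<le> ennreal (1 * G + C * A)"
      using interp[of 1] by auto
    define d where "d = \<epsilon> / (1 + \<kappa>\<^sub>q + C)"
    have d: "0 < d" "d + (1 * (\<kappa>\<^sub>q * d) + C * d) = \<epsilon>"
    proof -
      have pos: "0 < 1 + \<kappa>\<^sub>q + C" using \<kappa>q(1) C(1) by simp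
      with \<epsilon> show "0 < d" by (simp add: d_def)
      have "(1 + \<kappa>\<^sub>q + C) * d = \<epsilon>" using pos by (simp add: d_def)
      then show "d + (1 * (\<kappa>\<^sub>q * d) + C * d) = \<epsilon>" by (simp add: distrib_right)
    qed
    show ?thesis
    proof (intro exI[of _ "ennreal d"] conjI ballI impI)
      show "0 < ennreal d" using d by simp
      fix v assume v: "v \<in> elems (N_space M s p q)"
        and less: "qnorm (N_space M s p q) (\<lambda>x. v x - u x) < ennreal d"
      let ?w = "\<lambda>x. v x - u x"
      have w: "?w \<in> borel_measurable M"
        using u v by (intro borel_measurable_ereal_diff meas) (auto simp: N_space_def)
      have wd: "Lp_qnorm M p ?w < ennreal d" "N_hom_qnorm M s p q ?w < ennreal d"
        using less by (auto simp: N_space_def intro: le_less_trans[rotated])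
      have "H ?w \<le> ennreal (1 * (\<kappa>\<^sub>q * d) + C * d)"
        using wd d \<kappa>q exponents_nonneg[OF pe]
        by (intro C(2)[OF w] \<kappa>q(2) modular_le_1_of_Lp_qnorm_less) auto
      then have "qnorm Z ?w \<le> ennreal d + ennreal (1 * (\<kappa>\<^sub>q * d) + C * d)"
        unfolding Z using wd(1) by (intro add_mono) auto
      also have "\<dots> = ennreal \<epsilon>"
        unfolding d(2)[symmetric] using d \<kappa>q C by (intro ennreal_plus[symmetric]) auto
      finally show "qnorm Z ?w < e" using \<epsilon> by simp
    qed
  qed
  have tb: "qn_totally_bounded Z B" if B: "qn_bounded (N_space M s p q) B" for B
    unfolding qn_totally_bounded_def
  proof (intro conjI allI impI)
    have BN: "B \<subseteq> elems (N_space M s p q)" using B by (simp add: qn_bounded_def)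
    with sub show "B \<subseteq> elems Z" by simp
    have BL: "u \<in> borel_measurable M" if "u \<in> B" for u
      using that BN by (intro meas) (auto simp: N_space_def)
    obtain C0 where C0: "C0 < \<infinity>" "\<And>u. u \<in> B \<Longrightarrow> qnorm (N_space M s p q) u \<le> C0"
      using B by (auto simp: qn_bounded_def)
    obtain m where m: "0 < m" "\<And>u. u \<in> B \<Longrightarrow> N_hom_qnorm M s p q u < ennreal m"
    proof -
      obtain v where v: "C0 = ennreal v" "0 \<le> v" using C0(1) by (cases C0) auto
      show thesis
      proof (rule that[of "v + 1"])
        fix u assume "u \<in> B"
        have "N_hom_qnorm M s p q u \<le> qnorm (N_space M s p q) u" by (simp add: N_space_def)
        also have "\<dots> \<le> ennreal v" using C0(2)[OF \<open>u \<in> B\<close>] v by simp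
        also have "\<dots> < ennreal (v + 1)" using v by (simp add: ennreal_less_iff)
        finally show "N_hom_qnorm M s p q u < ennreal (v + 1)" .
      qed (use v in simp)
    qed
    define G where "G = \<kappa>\<^sub>d * (\<kappa>\<^sub>q * m)"
    have G: "0 < G" using \<kappa>d \<kappa>q m by (simp add: G_def)
    fix e :: ennreal assume e: "0 < e"
    obtain \<epsilon> where \<epsilon>: "0 < \<epsilon>" "ennreal \<epsilon> < e" using small[OF e] by blast
    have eG: "0 < \<epsilon> / (2 * G)" using \<epsilon> G by simp
    obtain C where C: "0 < C" "\<And>u G' A. u \<in> borel_measurable M \<Longrightarrow> 0 < G' \<Longrightarrow> 0 < A \<Longrightarrow>
       gradient_bound M s p u G' \<Longrightarrow> modular M p (\<lambda>x. u x / ereal A) \<le> 1 \<Longrightarrow>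
       H u \<le> ennreal (\<epsilon> / (2 * G) * G' + C * A)"
      using interp[OF eG] by auto
    define \<delta> where "\<delta> = \<epsilon> / (2 * \<kappa>\<^sub>p * (1 + C))"
    have \<delta>: "0 < \<delta>" "0 < \<kappa>\<^sub>p * \<delta>" "\<kappa>\<^sub>p * \<delta> + (\<epsilon> / (2 * G) * G + C * (\<kappa>\<^sub>p * \<delta>)) = \<epsilon>"
    proof -
      show "0 < \<delta>" using \<epsilon> \<kappa>p C by (auto simp: \<delta>_def)
      then show "0 < \<kappa>\<^sub>p * \<delta>" using \<kappa>p by simp
      have "\<kappa>\<^sub>p \<noteq> 0" "1 + C \<noteq> 0" using \<kappa>p(1) C(1) by auto
      then have "(1 + C) * (\<kappa>\<^sub>p * \<delta>) = \<epsilon> / 2" by (simp add: \<delta>_def divide_simps)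
      moreover have "\<epsilon> / (2 * G) * G = \<epsilon> / 2" using G by simp
      ultimately show "\<kappa>\<^sub>p * \<delta> + (\<epsilon> / (2 * G) * G + C * (\<kappa>\<^sub>p * \<delta>)) = \<epsilon>"
        by (simp add: distrib_right)
    qed
    have tbL: "qn_totally_bounded (Lp_space M p) B"
      using compact B by (simp add: compactly_embedded_def)
    have "0 < ennreal \<delta>" using \<delta> by simp
    with tbL obtain F where F: "finite F" "F \<subseteq> elems (Lp_space M p)"
      "\<forall>u\<in>B. \<exists>v\<in>F. qnorm (Lp_space M p) (\<lambda>x. u x - v x) < ennreal \<delta>"
      using tbL[unfolded qn_totally_bounded_def, THEN conjunct2, THEN spec, of "ennreal \<delta>"] by auto
    have near: "qnorm (Lp_space M p) = Lp_qnorm M p" by (simp add: Lp_space_def)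
    (* The centres v of the given net are only in the Lebesgue space, without a gradient. They are
       replaced by nearby members of B, whose mutual differences have gradient bound G. *)
    define f where "f v = (SOME u. u \<in> B \<and> Lp_qnorm M p (\<lambda>x. u x - v x) < ennreal \<delta>)" for v
    define F' where "F' = f ` {v\<in>F. \<exists>u. u \<in> B \<and> Lp_qnorm M p (\<lambda>x. u x - v x) < ennreal \<delta>}"
    have f: "f v \<in> B \<and> Lp_qnorm M p (\<lambda>x. f v x - v x) < ennreal \<delta>"
      if "\<exists>u. u \<in> B \<and> Lp_qnorm M p (\<lambda>x. u x - v x) < ennreal \<delta>" for v
      unfolding f_def using that by (rule someI_ex)
    show "\<exists>F. finite F \<and> F \<subseteq> elems Z \<and> (\<forall>u\<in>B. \<exists>v\<in>F. qnorm Z (\<lambda>x. u x - v x) < e)"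
    proof (intro exI[of _ F'] conjI ballI)
      show "finite F'" using F by (simp add: F'_def)
      have "F' \<subseteq> B" using f by (auto simp: F'_def)
      then show "F' \<subseteq> elems Z" using BN sub by blast
      fix u assume u: "u \<in> B"
      then obtain v where v: "v \<in> F" "Lp_qnorm M p (\<lambda>x. u x - v x) < ennreal \<delta>"
        using F(3) near by auto
      with u have fv: "f v \<in> F'" "f v \<in> B" "Lp_qnorm M p (\<lambda>x. f v x - v x) < ennreal \<delta>"
        using f[of v] by (auto simp: F'_def)
      let ?w = "\<lambda>x. u x - f v x"
      have vm: "v \<in> borel_measurable M" using v F meas by auto
      have w: "?w \<in> borel_measurable M"
        using BL u fv by (intro borel_measurable_ereal_diff) auto
      have wp: "modular M p (\<lambda>x. ?w x / ereal (\<kappa>\<^sub>p * \<delta>)) \<le> 1"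
      proof (rule \<kappa>p(2))
        show "\<bar>u x - f v x\<bar> \<le> \<bar>u x - v x\<bar> + \<bar>f v x - v x\<bar>" for x
          by (cases "u x"; cases "v x"; cases "f v x") auto
        show "modular M p (\<lambda>x. (u x - v x) / ereal \<delta>) \<le> 1"
          "modular M p (\<lambda>x. (f v x - v x) / ereal \<delta>) \<le> 1"
          using v fv exponents_nonneg[OF pe] by (auto intro: modular_le_1_of_Lp_qnorm_less)
      qed (use BL u fv vm \<delta> in \<open>auto intro: borel_measurable_ereal_diff\<close>)
      have "gradient_bound M s p ?w G"
        unfolding G_def using \<kappa>q m u fv by (intro \<kappa>d(2) \<kappa>q(2)) auto
      then have "H ?w \<le> ennreal (\<epsilon> / (2 * G) * G + C * (\<kappa>\<^sub>p * \<delta>))"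
        using w wp G \<delta> by (intro C(2)) auto
      moreover have "Lp_qnorm M p ?w \<le> ennreal (\<kappa>\<^sub>p * \<delta>)"
        using \<delta>(2) wp by (rule Lp_qnorm_le)
      ultimately have "qnorm Z ?w \<le> ennreal (\<kappa>\<^sub>p * \<delta>) + ennreal (\<epsilon> / (2 * G) * G + C * (\<kappa>\<^sub>p * \<delta>))"
        unfolding Z by (intro add_mono)
      also have "\<dots> = ennreal (\<kappa>\<^sub>p * \<delta> + (\<epsilon> / (2 * G) * G + C * (\<kappa>\<^sub>p * \<delta>)))"
        using \<delta>(1,2) \<epsilon>(1) G C(1) by (subst ennreal_plus) auto
      also have "\<dots> = ennreal \<epsilon>" by (simp only: \<delta>(3))
      finally have "qnorm Z ?w < e" using \<epsilon> by simp
      with fv show "\<exists>v\<in>F'. qnorm Z (\<lambda>x. u x - v x) < e" by blast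
    qed
  qed
  show ?thesis
    unfolding compactly_embedded_def qn_continuous_inclusion_def using sub cont tb by blast
qed

lemma compactly_embedded_of_stronger_qnorm:
  assumes c: "Y \<hookrightarrow>\<hookrightarrow> Z" and el: "elems Z \<subseteq> elems W" and le: "\<And>u. qnorm W u \<le> qnorm Z u"
  shows "Y \<hookrightarrow>\<hookrightarrow> W"
proof -
  have "qn_continuous_inclusion Y W"
    using c el le unfolding compactly_embedded_def qn_continuous_inclusion_def
    by (meson le_less_trans order_trans)
  moreover have "qn_totally_bounded W B" if "qn_bounded Y B" for B
  proof -
    have "qn_totally_bounded Z B" using c that by (simp add: compactly_embedded_def)
    then show ?thesis using el le unfolding qn_totally_bounded_def
      by (meson le_less_trans order_trans)
  qed
  ultimately show ?thesis by (simp add: compactly_embedded_def)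
qed

text \<open>The witness for the implication from (ii) to (iii).\<close>

lemma half_exponent:
  assumes s: "s \<in> bounded_exponents M"
  shows "(\<lambda>x. s x / 2) \<in> bounded_exponents M" "exponent_ll M (\<lambda>x. s x / 2) s"
proof -
  have sm: "s \<in> borel_measurable M" and pos: "\<And>x. x \<in> space M \<Longrightarrow> 0 < s x"
    using s by (auto simp: bounded_exponents_def exponents_def)
  have "s \<in> exponents M" using s by (simp add: bounded_exponents_def)
  then obtain \<sigma> where \<sigma>: "0 < \<sigma>" "AE x in M. ereal \<sigma> \<le> s x" using exponents_AE_ge by blast
  obtain S where S: "AE x in M. s x \<le> ereal S" using bounded_exponents_AE_le[OF s] .
  have hm: "(\<lambda>x. s x / 2) \<in> borel_measurable M"
    using sm by (intro borel_measurable_ereal_divide) auto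
  have essinf_ge: "0 < essinf M f" if "f \<in> borel_measurable M" "AE x in M. ereal (\<sigma> / 2) \<le> f x" for f
  proof -
    have "esssup M (\<lambda>x. - f x) \<le> - ereal (\<sigma> / 2)"
      using that(1)
    proof (intro esssup_I)
      show "AE x in M. - f x \<le> - ereal (\<sigma> / 2)"
        using that(2) by eventually_elim (simp only: ereal_minus_le_minus)
    qed auto
    then have "- (- ereal (\<sigma> / 2)) \<le> - esssup M (\<lambda>x. - f x)" by (simp only: ereal_minus_le_minus)
    then have "ereal (\<sigma> / 2) \<le> essinf M f" by (simp add: essinf_def)
    moreover have "0 < ereal (\<sigma> / 2)" using \<sigma> by simp
    ultimately show ?thesis by (rule less_le_trans[rotated])
  qed
  have 1: "AE x in M. ereal (\<sigma> / 2) \<le> s x / 2"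
    using \<sigma>(2)
  proof eventually_elim
    case (elim x) then show ?case by (cases "s x") auto
  qed
  have 2: "AE x in M. ereal (\<sigma> / 2) \<le> s x - s x / 2"
    using \<sigma>(2)
  proof eventually_elim
    case (elim x) then show ?case by (cases "s x") auto
  qed
  have "AE x in M. s x / 2 \<le> ereal (S / 2)"
    using S AE_space
  proof eventually_elim
    case (elim x) then show ?case using pos[of x] by (cases "s x") auto
  qed
  then have "esssup M (\<lambda>x. s x / 2) \<le> ereal (S / 2)" by (rule esssup_I[OF hm])
  then have "esssup M (\<lambda>x. s x / 2) < \<infinity>" by (rule le_less_trans) simp
  moreover have "0 < s x / 2" if "x \<in> space M" for x
    using pos[OF that] by (cases "s x") auto
  ultimately show "(\<lambda>x. s x / 2) \<in> bounded_exponents M"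
    using hm essinf_ge[OF hm 1] by (simp add: bounded_exponents_def exponents_def)
  show "exponent_ll M (\<lambda>x. s x / 2) s"
    unfolding exponent_ll_def using sm hm by (intro essinf_ge 2 borel_measurable_ereal_diff)
qed

theorem theorem3p16:
  fixes M :: "'a::metric_space measure"
    and p s q :: "'a \<Rightarrow> ereal"
  assumes "metric_measure_space M"
    and "p \<in> bounded_exponents M"
    and "s \<in> bounded_exponents M"
    and "q \<in> exponents M"
  shows "(N_space M s p q \<hookrightarrow>\<hookrightarrow> Lp_space M p \<longleftrightarrow>
           (\<forall>r\<in>exponents M. \<forall>t\<in>bounded_exponents M. exponent_ll M t s \<longrightarrow>
              N_space M s p q \<hookrightarrow>\<hookrightarrow> M_space M t p r \<and>
              N_space M s p q \<hookrightarrow>\<hookrightarrow> N_space M t p r))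
       \<and> ((\<forall>r\<in>exponents M. \<forall>t\<in>bounded_exponents M. exponent_ll M t s \<longrightarrow>
              N_space M s p q \<hookrightarrow>\<hookrightarrow> M_space M t p r \<and>
              N_space M s p q \<hookrightarrow>\<hookrightarrow> N_space M t p r) \<longleftrightarrow>
           (\<exists>r\<in>exponents M. \<exists>t\<in>bounded_exponents M. exponent_ll M t s \<and>
              (N_space M s p q \<hookrightarrow>\<hookrightarrow> M_space M t p r \<or>
               N_space M s p q \<hookrightarrow>\<hookrightarrow> N_space M t p r)))"
    (is "(?i \<longleftrightarrow> ?ii) \<and> (?ii \<longleftrightarrow> ?iii)")
proof -
  have "?ii" if i: ?i
  proof (intro ballI impI)
    fix r t assume r: "r \<in> exponents M" and t: "t \<in> bounded_exponents M" and ts: "exponent_ll M t s"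
    note interp = hom_qnorm_interpolation[OF assms(1,2,3) t ts r]
    show "N_space M s p q \<hookrightarrow>\<hookrightarrow> M_space M t p r \<and> N_space M s p q \<hookrightarrow>\<hookrightarrow> N_space M t p r"
    proof
      show "N_space M s p q \<hookrightarrow>\<hookrightarrow> M_space M t p r"
        by (rule compactly_embedded_of_interpolation[OF assms(2,4) i, where H="M_hom_qnorm M t p r"])
          (simp add: M_space_def, simp add: M_space_def, erule interp, blast)
      show "N_space M s p q \<hookrightarrow>\<hookrightarrow> N_space M t p r"
        by (rule compactly_embedded_of_interpolation[OF assms(2,4) i, where H="N_hom_qnorm M t p r"])
          (simp add: N_space_def, simp add: N_space_def, erule interp, blast)
    qed
  qed
  moreover have ?iii if ?ii
    using that half_exponent[OF assms(3)] assms(4) by blast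
  moreover have ?i if ?iii
  proof -
    have M: "elems (M_space M t p r) \<subseteq> elems (Lp_space M p)"
      "qnorm (Lp_space M p) u \<le> qnorm (M_space M t p r) u" for t r u
      by (auto simp: M_space_def Lp_space_def)
    have N: "elems (N_space M t p r) \<subseteq> elems (Lp_space M p)"
      "qnorm (Lp_space M p) u \<le> qnorm (N_space M t p r) u" for t r u
      by (auto simp: N_space_def Lp_space_def)
    from that show ?i
      using compactly_embedded_of_stronger_qnorm[OF _ M] compactly_embedded_of_stronger_qnorm[OF _ N]
      by blast
  qed
  ultimately show ?thesis by blast
qed

end
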